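(* Let $X\subset S^{n-1}\subset\mathbb{R}^n$ be a finite antipodal set that is a spherical $t$-design and an $s$-distance set with $t\ge 2s-3$. Then $X$, with the relations determined by the inner products between its points, is an association scheme of class $s$; let $P=(P_j(i))$ and $Q=(Q_j(i))$ be its first and second eigenmatrices and $q_{i,j}^k$ ($0\le i,j,k\le s$) its Krein numbers. There are an ordering $D_0,D_1,\dots,D_s$ of the adjacency matrices (with $D_0=I$) and an ordering $E_0,E_1,\dots,E_s$ of the primitive idempotents (with $E_0=\frac1{|X|}J$) such that all of the following hold. (1) $P_1(i)=(-1)^i$ for all $0\le i\le s$. (2) $Q_j(2i+1)=(-1)^jQ_j(2i)$ for all $i,j$ with $1\le 2i+1\le s$ and $0\le j\le s$. If $s$ is even, then $Q_j(s)=0$ for every odd integer $j$ with $1\le j\le s-1$. (3) The multiplicities $m_i=Q_i(0)$ are $$m_i=\binom{n+i-1}{i}-\binom{n+i-3}{i-2}\quad(0\le i\le s-2),$$ $$m_{s-1}=\frac{|X|}{2}-\binom{n+s-4}{s-3},\qquad m_s=\frac{|X|}{2}-\binom{n+s-3}{s-2}.$$ (4) $q_{\mu,i}^j=0$ for all $0\le\mu,i,j\le s$ such that $\mu+i+j$ is odd. (5) The dual intersection matrix $B_1^*=(q_{1,i}^j)_{0\le i,j\le s}$ is tridiagonal, that is, the association scheme is Q-polynomial (with respect to the ordering $E_0,\dots,E_s$). More precisely, the diagonal entries $q_{1,i}^i$ are all $0$, and writing $c_i^*=q_{1,i-1}^i$ ($1\le i\le s$) and $b_i^*=q_{1,i+1}^i$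 ($0\le i\le s-1$), one has $$c_i^*=\frac{ni}{n+2i-2}\quad(1\le i\le s-2),$$ $$c_{s-1}^*=\frac{2n(n-1)(n+s-4)!}{(s-2)!\,(n-1)!\,|X|-2(s-2)(n+s-4)!},\qquad c_s^*=n,$$ $$b_0^*=n,\qquad b_i^*=\frac{n(n+i-2)}{n+2i-2}\quad(1\le i\le s-3),\qquad b_{s-2}^*=\frac{n(n+s-4)}{n+2s-6},$$ $$b_{s-1}^*=\frac{(s-2)!\,n!\,|X|-2n(n+s-3)!}{(s-2)!\,(n-1)!\,|X|-2(s-2)(n+s-4)!}.$$
   Context: $S^{n-1}$ is the unit sphere in $\mathbb{R}^n$ and $\boldsymbol x\cdot\boldsymbol y$ is the standard inner product. A finite nonempty subset $X\subset S^{n-1}$ is a spherical $t$-design if $\frac{1}{|X|}\sum_{\boldsymbol x\in X}f(\boldsymbol x)=\frac{1}{|S^{n-1}|}\int_{S^{n-1}}f\,d\sigma$ for every real polynomial $f$ in $n$ variables of degree at most $t$. $X$ is an $s$-distance set if exactly $s$ distinct values occur as $\boldsymbol x\cdot\boldsymbol y$ with $\boldsymbol x\neq\boldsymbol y$ in $X$. $X$ is antipodal if $\boldsymbol x\in X$ implies $-\boldsymbol x\in X$. A symmetric association scheme of class $s$ on a finite set $X$ is a partition of $X\times X$ into nonempty symmetric relations $R_0,\dots,R_s$, with $R_0$ the diagonal, such that for all $i,j,k$ the number $|\{z\in X\mid (x,z)\in R_i,\ (z,y)\in R_j\}|$ is the same for all $(x,y)\in R_k$. Here the relations are $R_i=\{(\boldsymbol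 x,\boldsymbol y)\in X\times X\mid\boldsymbol x\cdot\boldsymbol y=\alpha_i\}$, where $\alpha_0=1$ and $\alpha_1,\dots,\alpha_s$ are the inner products between distinct points of $X$ in some order. The adjacency matrices $D_i$ are the $0/1$ matrices of the $R_i$. Their real span is the Bose–Mesner algebra, a commutative matrix algebra of dimension $s+1$, which has a unique basis of primitive idempotents $E_0,\dots,E_s$ (up to order), one of which is $\frac{1}{|X|}J$, where $J$ is the all-ones matrix. The eigenmatrices are defined by $D_j=\sum_{i=0}^sP_j(i)E_i$ and $|X|E_j=\sum_{i=0}^sQ_j(i)D_i$. The multiplicity is $m_i=\operatorname{rank}E_i=Q_i(0)$. The Krein numbers are defined by $(|X|E_i)\circ(|X|E_j)=\sum_{k=0}^sq_{i,j}^k\,|X|E_k$, where $\circ$ is the entrywise product. The scheme is Q-polynomial with respect to the ordering $E_0,\dots,E_s$ if the matrix $(q_{1,i}^j)_{0\le i,j\le s}$ is tridiagonal with all entries immediately above and below the diagonal nonzero. Binomial coefficients $\binom{a}{b}$ with $b<0$ are $0$.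
   Formalization: The explicit values in (5) are claimed only if s≥3 or X is a spherical 2-design (false otherwise, e.g. X={x,-x}, n≥2: c_s^*=1); the formulas for c_{s-1}^*, b_{s-2}^*, b_{s-1}^* only for s≥2, and the b_{s-2}^* formula not at n=s=2, where it reads 0/0. *)

theory Defs
  imports "HOL-Analysis.Analysis"
begin

section \<open>Spherical designs\<close>

text \<open>
  The surface measure of the unit sphere, as a Borel measure on the ambient space concentrated on the
  sphere: a Borel set A of unit vectors has surface area n times the Lebesgue measure of the cone
  {r a | 0 < r < 1, a in A} over it.  The centre of the ball is a null set.
\<close>

definition sphere_measure :: "(real ^ 'n::finite) measure" where
  "sphere_measure = scale_measure (ennreal (real CARD('n)))
     (distr (restrict_space lborel (ball 0 1)) borel (\<lambda>x. x /\<^sub>R norm x))"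

lemma emeasure_sphere_measure:
  "emeasure (sphere_measure :: (real ^ 'n::finite) measure) (sphere 0 1) =
     ennreal (real CARD('n)) * emeasure lborel (ball (0 :: real ^ 'n) 1)"
proof -
  let ?f = "\<lambda>x :: real ^ 'n. x /\<^sub>R norm x"
  let ?B = "ball (0 :: real ^ 'n) 1"
  have f: "?f \<in> restrict_space lborel ?B \<rightarrow>\<^sub>M borel"
    by (intro measurable_restrict_space1) simp
  have "?f -` sphere 0 1 \<inter> ?B = ?B - {0}"
    by (auto simp: norm_inverse)
  moreover have "emeasure lborel (?B - {0}) = emeasure lborel ?B"
    by (rule emeasure_Diff_null_set) auto
  ultimately show ?thesis
    by (simp add: sphere_measure_def emeasure_distr[OF f] space_restrict_space
        emeasure_restrict_space)
qed

definition poly_fun_deg_le :: "nat \<Rightarrow> (real ^ 'n::finite \<Rightarrow> real) \<Rightarrow> bool" where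
  "poly_fun_deg_le t f \<longleftrightarrow>
     (\<exists>c :: ('n \<Rightarrow> nat) \<Rightarrow> real. \<forall>x. f x =
        (\<Sum>k\<in>{k. (\<Sum>i\<in>UNIV. k i) \<le> t}. c k * (\<Prod>i\<in>UNIV. (x $ i) ^ k i)))"

lemma finite_exponents: "finite {k :: 'n::finite \<Rightarrow> nat. (\<Sum>i\<in>UNIV. k i) \<le> t}"
proof (rule finite_subset)
  show "{k :: 'n \<Rightarrow> nat. (\<Sum>i\<in>UNIV. k i) \<le> t} \<subseteq> Pi\<^sub>E UNIV (\<lambda>_. {..t})"
  proof
    fix k :: "'n \<Rightarrow> nat" assume "k \<in> {k. (\<Sum>i\<in>UNIV. k i) \<le> t}"
    then have "k i \<le> t" for i
      using member_le_sum[of i UNIV k] by simp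
    then show "k \<in> Pi\<^sub>E UNIV (\<lambda>_. {..t})" by auto
  qed
qed (intro finite_PiE; simp)

definition spherical_design :: "nat \<Rightarrow> (real ^ 'n::finite) set \<Rightarrow> bool" where
  "spherical_design t X \<longleftrightarrow> finite X \<and> X \<noteq> {} \<and> X \<subseteq> sphere 0 1 \<and>
     (\<forall>f. poly_fun_deg_le t f \<longrightarrow>
        (\<Sum>x\<in>X. f x) / real (card X) =
        (LINT x:sphere 0 1|sphere_measure. f x) /
          measure (sphere_measure :: (real ^ 'n) measure) (sphere 0 1))"

definition inner_products :: "'a::real_inner set \<Rightarrow> real set" where
  "inner_products X = {x \<bullet> y | x y. x \<in> X \<and> y \<in> X \<and> x \<noteq> y}"

definition distance_set :: "nat \<Rightarrow> 'a::real_inner set \<Rightarrow> bool" where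
  "distance_set s X \<longleftrightarrow> finite (inner_products X) \<and> card (inner_products X) = s"

definition antipodal :: "'a::ab_group_add set \<Rightarrow> bool" where
  "antipodal X \<longleftrightarrow> (\<forall>x\<in>X. - x \<in> X)"

definition inner_product_ordering :: "'a::real_inner set \<Rightarrow> nat \<Rightarrow> (nat \<Rightarrow> real) \<Rightarrow> bool" where
  "inner_product_ordering X s \<alpha> \<longleftrightarrow> \<alpha> 0 = 1 \<and> bij_betw \<alpha> {1..s} (inner_products X)"

definition inner_rel :: "'a::real_inner set \<Rightarrow> (nat \<Rightarrow> real) \<Rightarrow> nat \<Rightarrow> ('a \<times> 'a) set" where
  "inner_rel X \<alpha> i = {(x, y). x \<in> X \<and> y \<in> X \<and> x \<bullet> y = \<alpha> i}"


section \<open>Symmetric association schemes\<close>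

definition association_scheme :: "'a set \<Rightarrow> nat \<Rightarrow> (nat \<Rightarrow> ('a \<times> 'a) set) \<Rightarrow> bool" where
  "association_scheme X s R \<longleftrightarrow> finite X \<and>
     (\<Union>i\<le>s. R i) = X \<times> X \<and>
     (\<forall>i\<le>s. \<forall>j\<le>s. i \<noteq> j \<longrightarrow> R i \<inter> R j = {}) \<and>
     (\<forall>i\<le>s. R i \<noteq> {} \<and> sym (R i)) \<and>
     R 0 = Id_on X \<and>
     (\<forall>i\<le>s. \<forall>j\<le>s. \<forall>k\<le>s. \<exists>p. \<forall>(x, y)\<in>R k. card {z \<in> X. (x, z) \<in> R i \<and> (z, y) \<in> R j} = p)"

text \<open>
  A real matrix with rows and columns indexed by X is a function of two arguments that
  vanishes outside X \<times> X.
\<close>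

type_synonym 'a rmat = "'a \<Rightarrow> 'a \<Rightarrow> real"

definition zero_mat :: "'a rmat" where
  "zero_mat = (\<lambda>x y. 0)"

definition all_ones :: "'a set \<Rightarrow> 'a rmat" where
  "all_ones X = (\<lambda>x y. if x \<in> X \<and> y \<in> X then 1 else 0)"

definition mat_prod :: "'a set \<Rightarrow> 'a rmat \<Rightarrow> 'a rmat \<Rightarrow> 'a rmat" where
  "mat_prod X A B = (\<lambda>x y. \<Sum>z\<in>X. A x z * B z y)"

definition lin_comb :: "nat \<Rightarrow> (nat \<Rightarrow> real) \<Rightarrow> (nat \<Rightarrow> 'a rmat) \<Rightarrow> 'a rmat" where
  "lin_comb s c M = (\<lambda>x y. \<Sum>i\<le>s. c i * M i x y)"

definition adj_mat :: "('a \<times> 'a) set \<Rightarrow> 'a rmat" where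
  "adj_mat R = (\<lambda>x y. if (x, y) \<in> R then 1 else 0)"

definition bose_mesner :: "nat \<Rightarrow> (nat \<Rightarrow> 'a rmat) \<Rightarrow> 'a rmat set" where
  "bose_mesner s D = {lin_comb s c D | c. True}"

definition idempotent :: "'a set \<Rightarrow> 'a rmat \<Rightarrow> bool" where
  "idempotent X e \<longleftrightarrow> mat_prod X e e = e"

definition primitive_idempotent :: "'a set \<Rightarrow> 'a rmat set \<Rightarrow> 'a rmat \<Rightarrow> bool" where
  "primitive_idempotent X \<A> e \<longleftrightarrow>
     e \<in> \<A> \<and> e \<noteq> zero_mat \<and> idempotent X e \<and>
     \<not> (\<exists>f\<in>\<A>. \<exists>g\<in>\<A>. f \<noteq> zero_mat \<and> g \<noteq> zero_mat \<and> idempotent X f \<and> idempotent X g \<and>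
          mat_prod X f g = zero_mat \<and> mat_prod X g f = zero_mat \<and> e = (\<lambda>x y. f x y + g x y))"

definition idempotent_ordering :: "'a set \<Rightarrow> nat \<Rightarrow> (nat \<Rightarrow> 'a rmat) \<Rightarrow> (nat \<Rightarrow> 'a rmat) \<Rightarrow> bool" where
  "idempotent_ordering X s D E \<longleftrightarrow>
     bij_betw E {0..s} {e. primitive_idempotent X (bose_mesner s D) e} \<and>
     E 0 = (\<lambda>x y. all_ones X x y / real (card X))"

text \<open>In the following, P j i, Q j i and q i j k stand for $P_j(i)$, $Q_j(i)$ and $q_{i,j}^k$.\<close>

definition first_eigenmatrix ::
    "nat \<Rightarrow> (nat \<Rightarrow> 'a rmat) \<Rightarrow> (nat \<Rightarrow> 'a rmat) \<Rightarrow> (nat \<Rightarrow> nat \<Rightarrow> real) \<Rightarrow> bool" where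
  "first_eigenmatrix s D E P \<longleftrightarrow> (\<forall>j\<le>s. D j = lin_comb s (P j) E)"

definition second_eigenmatrix ::
    "'a set \<Rightarrow> nat \<Rightarrow> (nat \<Rightarrow> 'a rmat) \<Rightarrow> (nat \<Rightarrow> 'a rmat) \<Rightarrow> (nat \<Rightarrow> nat \<Rightarrow> real) \<Rightarrow> bool" where
  "second_eigenmatrix X s D E Q \<longleftrightarrow>
     (\<forall>j\<le>s. (\<lambda>x y. real (card X) * E j x y) = lin_comb s (Q j) D)"

definition krein_numbers ::
    "'a set \<Rightarrow> nat \<Rightarrow> (nat \<Rightarrow> 'a rmat) \<Rightarrow> (nat \<Rightarrow> nat \<Rightarrow> nat \<Rightarrow> real) \<Rightarrow> bool" where
  "krein_numbers X s E q \<longleftrightarrow>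
     (\<forall>i\<le>s. \<forall>j\<le>s. (\<lambda>x y. (real (card X) * E i x y) * (real (card X) * E j x y)) =
        lin_comb s (q i j) (\<lambda>k x y. real (card X) * E k x y))"

definition Q_polynomial :: "nat \<Rightarrow> (nat \<Rightarrow> nat \<Rightarrow> nat \<Rightarrow> real) \<Rightarrow> bool" where
  "Q_polynomial s q \<longleftrightarrow>
     (\<forall>i\<le>s. \<forall>j\<le>s.
        (\<bar>int i - int j\<bar> > 1 \<longrightarrow> q 1 i j = 0) \<and> (\<bar>int i - int j\<bar> = 1 \<longrightarrow> q 1 i j \<noteq> 0))"

definition ibinom :: "int \<Rightarrow> int \<Rightarrow> real" where
  "ibinom a b = (if b < 0 then 0 else real_of_int a gchoose nat b)"

end

theory Submission
  imports Defs
begin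

text \<open>
  The sums over a design of strength t agree with means over the sphere for polynomials of degree at
  most t, and such means are computed in closed form.  Let $Q_k$ be the Gegenbauer polynomial of
  degree k normalised so that $Q_k(x \cdot y)$ is the reproducing kernel of the spherical harmonics
  of degree k (zonal below).  Then the mean over z of $Q_k(x \cdot z) Q_l(z \cdot y)$ is
  $\delta_{kl} Q_k(x \cdot y)$ (zonal_mean_zonal).  Since $2 (s - 2) \<le> t$, the matrices
  $E_k = Q_k(x \cdot y) / |X|$ with $k \<le> s - 2$ are therefore pairwise orthogonal idempotents.

  A function of the inner product on X is a function on the set A of the s + 1 inner products, so the
  span of the adjacency matrices has dimension s + 1, and only two idempotents are missing.  They come
  from antipodality.  The antipodal relation has an adjacency matrix D with $D^2 = I$, and the
  projections $(I + D) / 2$ and $(I - D) / 2$ act on the functions of the inner product by taking the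
  even and the odd part.  Each $E_k$ is even or odd like $Q_k$, so subtracting from each projection
  the $E_k$ of its parity leaves two further idempotents $E_{s-1}$ and $E_s$, of the parities of
  s - 1 and s, that are orthogonal to everything before (conv_efun).  They are nonzero because a
  polynomial of degree at most s - 2 cannot vanish at the s - 1 inner products other than 1 and -1
  unless it is zero (efun_nonzero).  The s + 1 idempotents span all functions on A
  (orthogonal_efun_eq_0); hence the span of the adjacency matrices is closed under multiplication,
  which is the statement that the intersection numbers exist.

  All numerical assertions are read off from the functions $f_i$ on A that belong to $|X| E_i$.  The
  multiplicity of $E_i$ is $f_i(1)$, the entries of Q are the values $f_j(\alpha_i)$, and parity
  accounts for the signs and for the vanishing Krein numbers.  The function $f_1$ is a multiple of
  the identity, so the Krein numbers $q_{1,i}^j$ describe the multiplication by the inner product.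
  For $i \<le> s - 3$ this is the three-term recurrence of the $Q_k$.  The remaining entries follow
  from the symmetry of $q_{i,j}^k m_k$ in its three indices, from parity, and from evaluating
  $f_1 f_i = \sum_k q_{1,i}^k f_k$ at 1.

  The mean over the sphere enters only through its invariance under orthogonal maps.  Invariance
  determines the mean of an even power of a linear form up to a constant; expanding the power of a
  linear form that depends on a parameter yields the recursion sphere_mean_two_powers for
  the means of $(x \cdot z)^a (y \cdot z)^b$, which is an integration by parts, and the orthogonality
  of the $Q_k$ is deduced from it by induction.
\<close>

section \<open>The mean over the unit sphere\<close>

definition sphere_mean :: "(real ^ 'n::finite \<Rightarrow> real) \<Rightarrow> real" where
  "sphere_mean f = (LINT x:sphere 0 1|sphere_measure. f x) /
     measure (sphere_measure :: (real ^ 'n) measure) (sphere 0 1)"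

text \<open>
  For c = 1 this is invariance under translations, for c = -1 under point reflections.
\<close>

lemma nn_integral_lborel_reflect:
  fixes f :: "'a::euclidean_space \<Rightarrow> ennreal"
  assumes [measurable]: "f \<in> borel_measurable borel" and c: "\<bar>c\<bar> = 1"
  shows "(\<integral>\<^sup>+x. f (a + c *\<^sub>R x) \<partial>lborel) = (\<integral>\<^sup>+x. f x \<partial>lborel)"
proof -
  have "(\<integral>\<^sup>+x. f x \<partial>lborel) = (\<integral>\<^sup>+x. f x \<partial>density (distr lborel borel (\<lambda>x. a + c *\<^sub>R x)) (\<lambda>_. ennreal (\<bar>c\<bar> ^ DIM('a))))"
    using c by (subst lborel_affine[of c a]) auto
  also have "\<dots> = (\<integral>\<^sup>+x. f (a + c *\<^sub>R x) \<partial>lborel)"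
    using c by (simp add: nn_integral_density nn_integral_distr)
  finally show ?thesis ..
qed

text \<open>
  This is the uniqueness argument for Haar measures.  With M the image measure, the double integral
  of $1_A(R x) 1_B(R x + y)$ over x and y is evaluated in both orders; by translation invariance one
  gets $M(A) \lambda(B)$ and $M(B) \lambda(A)$.  The unit ball B is invariant under R and has positive
  finite measure, so the factors $\lambda(B) = M(B)$ cancel.
\<close>

lemma lborel_distr_orthogonal:
  fixes R :: "'a::euclidean_space \<Rightarrow> 'a"
  assumes R: "orthogonal_transformation R"
  shows "distr lborel borel R = lborel"
proof (rule measure_eqI)
  have lin: "linear R" and norm: "norm (R x) = norm x" for x
    using R by (auto simp: orthogonal_transformation_linear orthogonal_transformation_norm)
  have [measurable]: "R \<in> borel_measurable borel"
    using lin by (simp add: borel_measurable_continuous_onI linear_continuous_on linear_linear)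
  define B :: "'a set" where "B = ball 0 1"
  have [measurable]: "B \<in> sets borel"
    by (simp add: B_def)
  have inB: "R x \<in> B \<longleftrightarrow> x \<in> B" for x
    by (simp add: B_def norm)
  fix A assume "A \<in> sets (distr lborel borel R)"
  then have [measurable]: "A \<in> sets borel" by simp
  let ?a = "indicator A :: 'a \<Rightarrow> ennreal" and ?b = "indicator B :: 'a \<Rightarrow> ennreal"
  have "emeasure (distr lborel borel R) A = (\<integral>\<^sup>+x. ?a x \<partial>distr lborel borel R)"
    by simp
  also have "\<dots> = (\<integral>\<^sup>+x. ?a (R x) \<partial>lborel)"
    by (subst nn_integral_distr) simp_all
  finally have "emeasure (distr lborel borel R) A * emeasure lborel B =
      (\<integral>\<^sup>+x. ?a (R x) * emeasure lborel B \<partial>lborel)"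
    by (simp add: nn_integral_multc)
  also have "\<dots> = (\<integral>\<^sup>+x. \<integral>\<^sup>+y. ?a (R x) * ?b (R x + y) \<partial>lborel \<partial>lborel)"
    using nn_integral_lborel_reflect[of ?b 1] by (simp add: nn_integral_cmult)
  also have "\<dots> = (\<integral>\<^sup>+y. \<integral>\<^sup>+x. ?a (R x) * ?b (R x + y) \<partial>lborel \<partial>lborel)"
    by (rule lborel_pair.Fubini'[symmetric]) measurable
  also have "\<dots> = (\<integral>\<^sup>+y. \<integral>\<^sup>+x. ?a (R x - y) * ?b (R x) \<partial>lborel \<partial>lborel)"
  proof (rule nn_integral_cong)
    fix y
    have shift: "R (- inv R y + x) = R x - y" for x
      using linear_diff[OF lin] orthogonal_transformation_surj[OF R] by (simp add: surj_f_inv_f)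
    show "(\<integral>\<^sup>+x. ?a (R x) * ?b (R x + y) \<partial>lborel) = (\<integral>\<^sup>+x. ?a (R x - y) * ?b (R x) \<partial>lborel)"
      using nn_integral_lborel_reflect[of "\<lambda>x. ?a (R x) * ?b (R x + y)" 1 "- inv R y"]
      by (simp add: shift del: add_uminus_conv_diff uminus_add_conv_diff)
  qed
  also have "\<dots> = (\<integral>\<^sup>+x. \<integral>\<^sup>+y. ?a (R x - y) * ?b (R x) \<partial>lborel \<partial>lborel)"
    by (rule lborel_pair.Fubini') measurable
  also have "\<dots> = (\<integral>\<^sup>+x. emeasure lborel A * ?b x \<partial>lborel)"
    using nn_integral_lborel_reflect[of ?a "-1"]
    by (intro nn_integral_cong) (simp add: nn_integral_multc inB indicator_eq_0_iff split: split_indicator)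
  also have "\<dots> = emeasure lborel A * emeasure lborel B"
    by (simp add: nn_integral_cmult)
  finally have *: "emeasure (distr lborel borel R) A * emeasure lborel B = emeasure lborel A * emeasure lborel B" .
  have "emeasure lborel B \<noteq> 0"
    using content_ball_pos[of 1 "0 :: 'a"] by (auto simp: B_def measure_def)
  moreover have "emeasure lborel B \<noteq> top"
    using emeasure_lborel_ball_finite[of "0 :: 'a" 1] by (simp add: B_def)
  ultimately show "emeasure (distr lborel borel R) A = emeasure lborel A"
    using arg_cong[OF *, of "\<lambda>x. x / emeasure lborel B"] by (simp add: mult_divide_eq_ennreal)
qed simp

lemma radial_measurable [measurable]:
  "(\<lambda>x :: real ^ 'n::finite. x /\<^sub>R norm x) \<in> borel_measurable borel"
  by measurable

lemma sphere_measurable [measurable]: "sphere (0 :: real ^ 'n::finite) 1 \<in> sets borel"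
  by (simp add: borel_closed)

lemma scale_measure_density: "scale_measure r M = density M (\<lambda>_. r)"
  by (rule measure_eqI) (auto simp: emeasure_density_const)

lemma set_lebesgue_integral_sphere_measure:
  fixes f :: "real ^ 'n::finite \<Rightarrow> real"
  assumes f [measurable]: "f \<in> borel_measurable borel"
  shows "(LINT x:sphere 0 1|sphere_measure. f x) =
    real CARD('n) * (LINT x:ball 0 1|lborel. f (x /\<^sub>R norm x))"
proof -
  let ?B = "restrict_space lborel (ball (0 :: real ^ 'n) 1)"
  let ?g = "\<lambda>x :: real ^ 'n. x /\<^sub>R norm x"
  have g [measurable]: "?g \<in> ?B \<rightarrow>\<^sub>M borel"
    by (intro measurable_restrict_space1) simp
  have ae: "AE x in lborel. x \<noteq> (0 :: real ^ 'n)"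
    by (rule AE_lborel_singleton)
  have "(LINT x:sphere 0 1|sphere_measure. f x) =
      (\<integral>x. indicator (sphere 0 1) x * f x \<partial>scale_measure (ennreal (real CARD('n))) (distr ?B borel ?g))"
    by (simp add: set_lebesgue_integral_def sphere_measure_def)
  also have "\<dots> = real CARD('n) * (\<integral>x. indicator (sphere 0 1) x * f x \<partial>distr ?B borel ?g)"
    unfolding scale_measure_density by (subst integral_density) auto
  also have "(\<integral>x. indicator (sphere 0 1) x * f x \<partial>distr ?B borel ?g) =
      (\<integral>x. indicator (sphere 0 1) (?g x) * f (?g x) \<partial>?B)"
    by (subst integral_distr) auto
  also have "\<dots> = (LINT x:ball 0 1|lborel. indicator (sphere 0 1) (?g x) * f (?g x))"
    by (subst integral_restrict_space) (auto simp: set_lebesgue_integral_def)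
  also have "\<dots> = (LINT x:ball 0 1|lborel. f (?g x))"
    unfolding set_lebesgue_integral_def
    by (intro integral_cong_AE) (use ae in \<open>auto simp: indicator_def norm_inverse\<close>)
  finally show ?thesis .
qed

lemma measure_sphere_measure:
  "measure (sphere_measure :: (real ^ 'n::finite) measure) (sphere 0 1) =
     real CARD('n) * measure lborel (ball (0 :: real ^ 'n) 1)"
proof -
  have "emeasure lborel (ball (0 :: real ^ 'n) 1) = ennreal (measure lborel (ball (0 :: real ^ 'n) 1))"
    using emeasure_lborel_ball_finite[of "0 :: real ^ 'n" 1]
    by (intro emeasure_eq_ennreal_measure) auto
  then show ?thesis
    unfolding measure_def[of sphere_measure]
    by (simp add: emeasure_sphere_measure ennreal_mult''[symmetric])
qed

text \<open>
  The surface measure is defined through cones, so a mean over the sphere is the mean over the ball of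
  the function extended to be constant on rays.
\<close>

lemma sphere_mean_ball:
  fixes f :: "real ^ 'n::finite \<Rightarrow> real"
  assumes "continuous_on UNIV f"
  shows "sphere_mean f =
    (LINT x:ball 0 1|lborel. f (x /\<^sub>R norm x)) / measure lborel (ball (0 :: real ^ 'n) 1)"
  using assms by (simp add: sphere_mean_def set_lebesgue_integral_sphere_measure
      measure_sphere_measure borel_measurable_continuous_onI)

lemma radial_integrable:
  fixes f :: "real ^ 'n::finite \<Rightarrow> real"
  assumes f: "continuous_on UNIV f"
  shows "set_integrable lborel (ball 0 1) (\<lambda>x. f (x /\<^sub>R norm x))"
proof -
  have [measurable]: "f \<in> borel_measurable borel"
    using f by (simp add: borel_measurable_continuous_onI)
  have "compact (f ` cball 0 1)"
    using f by (intro compact_continuous_image) (auto intro: continuous_on_subset)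
  then obtain C where C: "\<And>x. x \<in> cball 0 1 \<Longrightarrow> norm (f x) \<le> C"
    by (metis compact_imp_bounded bounded_iff imageI)
  show ?thesis
    unfolding set_integrable_def
  proof (rule integrableI_bounded_set[where A = "ball 0 1" and B = C])
    show "emeasure lborel (ball (0 :: real ^ 'n) 1) < \<infinity>"
      using emeasure_lborel_ball_finite[of "0 :: real ^ 'n" 1] by simp
    show "AE x in lborel. x \<in> ball 0 1 \<longrightarrow> norm (indicator (ball 0 1) x *\<^sub>R f (x /\<^sub>R norm x)) \<le> C"
    proof (intro AE_I2 impI)
      fix x :: "real ^ 'n" assume "x \<in> ball 0 1"
      moreover have "norm (x /\<^sub>R norm x) \<le> 1" by (cases "x = 0") simp_all
      ultimately show "norm (indicator (ball 0 1) x *\<^sub>R f (x /\<^sub>R norm x)) \<le> C"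
        using C[of "x /\<^sub>R norm x"] by simp
    qed
  qed (auto simp: indicator_def)
qed

lemma sphere_mean_add:
  assumes "continuous_on UNIV f" "continuous_on UNIV g"
  shows "sphere_mean (\<lambda>x. f x + g x) = sphere_mean f + sphere_mean g"
  using assms by (simp add: sphere_mean_ball continuous_on_add set_integral_add radial_integrable
      add_divide_distrib)

lemma sphere_mean_cmult:
  assumes "continuous_on UNIV f"
  shows "sphere_mean (\<lambda>x. c * f x) = c * sphere_mean f"
  using assms by (simp add: sphere_mean_ball continuous_on_mult_left)

lemma sphere_mean_sum:
  assumes "\<And>i. i \<in> I \<Longrightarrow> continuous_on UNIV (f i)"
  shows "sphere_mean (\<lambda>x. \<Sum>i\<in>I. f i x) = (\<Sum>i\<in>I. sphere_mean (f i))"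
  using assms
proof (induction I rule: infinite_finite_induct)
  case (insert i I)
  then show ?case
    by (simp add: sphere_mean_add continuous_on_sum)
qed (use sphere_mean_cmult[of "\<lambda>_. 0" 0] in simp_all)

lemma sphere_mean_one: "sphere_mean (\<lambda>x :: real ^ 'n::finite. 1) = 1"
proof -
  have "measure lborel (ball (0 :: real ^ 'n) 1) > 0"
    by (rule content_ball_pos) simp
  then show ?thesis
    by (simp add: sphere_mean_ball set_lebesgue_integral_def)
qed

lemma sphere_mean_cong:
  assumes "\<And>x. norm x = 1 \<Longrightarrow> f x = g x"
  shows "sphere_mean f = sphere_mean g"
  unfolding sphere_mean_def set_lebesgue_integral_def
  by (intro arg_cong2[where f = "(/)"] Bochner_Integration.integral_cong)
    (auto simp: indicator_def assms)

lemma sphere_mean_orthogonal: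
  fixes f :: "real ^ 'n::finite \<Rightarrow> real" and R :: "real ^ 'n \<Rightarrow> real ^ 'n"
  assumes f: "continuous_on UNIV f" and R: "orthogonal_transformation R"
  shows "sphere_mean (\<lambda>x. f (R x)) = sphere_mean f"
proof -
  have cont: "continuous_on UNIV R"
    using R by (simp add: linear_continuous_on linear_linear orthogonal_transformation_linear)
  then have [measurable]: "R \<in> borel_measurable borel" "f \<in> borel_measurable borel"
    using f by (auto simp: borel_measurable_continuous_onI)
  have [measurable]: "ball (0 :: real ^ 'n) 1 \<in> sets borel" by simp
  have "(LINT x:ball 0 1|lborel. f (x /\<^sub>R norm x)) =
      (\<integral>x. indicator (ball 0 1) x * f (x /\<^sub>R norm x) \<partial>distr lborel borel R)"
    by (simp add: lborel_distr_orthogonal[OF R] set_lebesgue_integral_def)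
  also have "\<dots> = (\<integral>x. indicator (ball 0 1) (R x) * f (R x /\<^sub>R norm (R x)) \<partial>lborel)"
    by (subst integral_distr) auto
  also have "\<dots> = (LINT x:ball 0 1|lborel. f (R (x /\<^sub>R norm x)))"
    using R by (simp add: set_lebesgue_integral_def indicator_def orthogonal_transformation_norm
        orthogonal_transformation_scaleR)
  finally show ?thesis
    using f cont by (simp add: sphere_mean_ball continuous_on_compose2[OF f])
qed

text \<open>
  Two vectors of the same length differ by an orthogonal map.
\<close>

lemma sphere_mean_linear_power_norm:
  fixes v w :: "real ^ 'n::finite"
  assumes "norm v = norm w"
  shows "sphere_mean (\<lambda>z. (v \<bullet> z) ^ m) = sphere_mean (\<lambda>z. (w \<bullet> z) ^ m)"
proof -
  obtain R where R: "orthogonal_transformation R" "R v = w"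
    using orthogonal_transformation_exists[OF assms] by blast
  have inner: "w \<bullet> R z = v \<bullet> z" for z
    using R unfolding orthogonal_transformation_def by blast
  have "continuous_on UNIV (\<lambda>z. (w \<bullet> z) ^ m)"
    by (intro continuous_intros)
  from sphere_mean_orthogonal[OF this R(1)] show ?thesis
    by (simp only: inner)
qed

lemma sphere_mean_uminus:
  fixes f :: "real ^ 'n::finite \<Rightarrow> real"
  assumes "continuous_on UNIV f"
  shows "sphere_mean (\<lambda>z. f (- z)) = sphere_mean f"
  by (rule sphere_mean_orthogonal[OF assms])
    (simp add: orthogonal_transformation_neg[of "\<lambda>x. x"])

lemma sphere_mean_odd:
  fixes f :: "real ^ 'n::finite \<Rightarrow> real"
  assumes "continuous_on UNIV f" "\<And>z. f (- z) = - f z"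
  shows "sphere_mean f = 0"
  using sphere_mean_uminus[OF assms(1)] sphere_mean_cmult[OF assms(1), of "-1"] assms(2) by simp

text \<open>
  An even power of the length of v is a power of $v \cdot v$, which is a polynomial in v.
\<close>

lemma sphere_mean_even_power:
  "\<exists>M. \<forall>v :: real ^ 'n::finite. sphere_mean (\<lambda>z. (v \<bullet> z) ^ (2 * j)) = M * (v \<bullet> v) ^ j"
proof -
  obtain e :: "real ^ 'n" where e: "norm e = 1"
    by (metis norm_axis_1)
  have "sphere_mean (\<lambda>z. (v \<bullet> z) ^ (2 * j)) = sphere_mean (\<lambda>z. (e \<bullet> z) ^ (2 * j)) * (v \<bullet> v) ^ j"
    for v :: "real ^ 'n"
  proof -
    have "sphere_mean (\<lambda>z. (v \<bullet> z) ^ (2 * j)) = sphere_mean (\<lambda>z. ((norm v *\<^sub>R e) \<bullet> z) ^ (2 * j))"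
      using e by (intro sphere_mean_linear_power_norm) simp
    also have "\<dots> = sphere_mean (\<lambda>z. norm v ^ (2 * j) * (e \<bullet> z) ^ (2 * j))"
      by (simp add: power_mult_distrib)
    also have "\<dots> = norm v ^ (2 * j) * sphere_mean (\<lambda>z. (e \<bullet> z) ^ (2 * j))"
      by (intro sphere_mean_cmult continuous_intros)
    also have "norm v ^ (2 * j) = (v \<bullet> v) ^ j"
      by (simp only: power_mult power2_norm_eq_inner)
    finally show ?thesis
      by (simp add: mult.commute)
  qed
  then show ?thesis by blast
qed

section \<open>Moments of linear forms\<close>

lemma coeff_quadratic_power:
  fixes a b c :: real
  shows "coeff ([:a, b, c:] ^ Suc m) 1 = real (Suc m) * a ^ m * b"
    and "coeff ([:a, b, c:] ^ Suc m) 2 =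
      real (Suc m) * a ^ m * c + real (Suc m) * real m / 2 * a ^ (m - 1) * b ^ 2"
proof -
  define p where "p = [:a, b, c:]"
  have mult: "coeff (p * r) 0 = a * coeff r 0" "coeff (p * r) 1 = a * coeff r 1 + b * coeff r 0"
    "coeff (p * r) 2 = a * coeff r 2 + b * coeff r 1 + c * coeff r 0" for r
    by (simp_all add: p_def coeff_mult numeral_2_eq_2)
  have 0: "coeff (p ^ k) 0 = a ^ k" for k
    by (induction k) (simp_all add: mult)
  have 1: "coeff (p ^ Suc k) 1 = real (Suc k) * a ^ k * b" for k
  proof (induction k)
    case 0
    then show ?case by (simp add: p_def)
  next
    case (Suc k)
    show ?case
      unfolding power_Suc[of p "Suc k"] mult Suc 0 by (simp add: algebra_simps)
  qed
  have 2: "coeff (p ^ Suc k) 2 =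
      real (Suc k) * a ^ k * c + real (Suc k) * real k / 2 * a ^ (k - 1) * b ^ 2" for k
  proof (induction k)
    case 0
    then show ?case by (simp add: p_def numeral_2_eq_2)
  next
    case (Suc k)
    then show ?case
      unfolding power_Suc[of p "Suc k"] mult Suc 0 1
      by (cases k) (simp_all add: field_simps power2_eq_square)
  qed
  show "coeff ([:a, b, c:] ^ Suc m) 1 = real (Suc m) * a ^ m * b"
    using 1 by (simp add: p_def)
  show "coeff ([:a, b, c:] ^ Suc m) 2 =
      real (Suc m) * a ^ m * c + real (Suc m) * real m / 2 * a ^ (m - 1) * b ^ 2"
    using 2 by (simp add: p_def)
qed

lemma coeff_sum_monom: "coeff (\<Sum>b\<le>m. monom (c b) b) k = (if k \<le> m then c k else 0)"
  by (simp add: coeff_sum)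

text \<open>
  As a function of the parameter e this mean is a polynomial, so that identities valid for all e can
  be compared coefficient by coefficient.
\<close>

lemma sphere_mean_binomial:
  fixes x y :: "real ^ 'n::finite"
  assumes g: "continuous_on UNIV g"
  shows "sphere_mean (\<lambda>z. ((x + e *\<^sub>R y) \<bullet> z) ^ m * g z) =
    poly (\<Sum>b\<le>m. monom (real (m choose b) *
      sphere_mean (\<lambda>z. (x \<bullet> z) ^ (m - b) * (y \<bullet> z) ^ b * g z)) b) e"
proof -
  have "((x + e *\<^sub>R y) \<bullet> z) ^ m * g z =
      (\<Sum>b\<le>m. (real (m choose b) * e ^ b) * ((x \<bullet> z) ^ (m - b) * (y \<bullet> z) ^ b * g z))" for z
    by (subst add.commute)
      (simp add: inner_add_left binomial_ring power_mult_distrib sum_distrib_left mult_ac)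
  then have "sphere_mean (\<lambda>z. ((x + e *\<^sub>R y) \<bullet> z) ^ m * g z) =
      (\<Sum>b\<le>m. sphere_mean (\<lambda>z. (real (m choose b) * e ^ b) * ((x \<bullet> z) ^ (m - b) * (y \<bullet> z) ^ b * g z)))"
    by (simp add: sphere_mean_sum g continuous_intros)
  also have "\<dots> = (\<Sum>b\<le>m. (real (m choose b) * e ^ b) *
      sphere_mean (\<lambda>z. (x \<bullet> z) ^ (m - b) * (y \<bullet> z) ^ b * g z))"
    by (intro sum.cong refl sphere_mean_cmult continuous_intros g)
  finally show ?thesis
    by (simp add: poly_sum poly_monom mult_ac)
qed

text \<open>
  Gaussian integration by parts, restricted to powers of one linear form.  In
  sphere_mean_even_power replace v by v + e w.  The coefficient of e computes
  the left-hand mean in terms of the constant M, and the coefficient of $e^2$, summed over an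
  orthonormal basis of vectors w, expresses M through the mean of $(v \cdot z)^{2j}$ because z is a
  unit vector.
\<close>

lemma sphere_mean_linear_power_inner:
  fixes v w :: "real ^ 'n::finite"
  shows "(real CARD('n) + 2 * real j) * sphere_mean (\<lambda>z. (v \<bullet> z) ^ (2 * j + 1) * (w \<bullet> z)) =
    real (2 * j + 1) * (v \<bullet> w) * sphere_mean (\<lambda>z. (v \<bullet> z) ^ (2 * j))"
proof -
  obtain M where M: "sphere_mean (\<lambda>z. (v \<bullet> z) ^ (2 * Suc j)) = M * (v \<bullet> v) ^ Suc j" for v :: "real ^ 'n"
    using sphere_mean_even_power[of "Suc j"] by blast
  have poly_eq: "(\<Sum>b\<le>2 * Suc j. monom (real (2 * Suc j choose b) *
      sphere_mean (\<lambda>z. (v \<bullet> z) ^ (2 * Suc j - b) * (w \<bullet> z) ^ b)) b) =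
      smult M ([:v \<bullet> v, 2 * (v \<bullet> w), w \<bullet> w:] ^ Suc j)" for w :: "real ^ 'n"
  proof (rule poly_eq_poly_eq_iff[THEN iffD1], rule ext)
    fix e :: real
    have "(v + e *\<^sub>R w) \<bullet> (v + e *\<^sub>R w) = poly [:v \<bullet> v, 2 * (v \<bullet> w), w \<bullet> w:] e"
      by (simp add: inner_add_left inner_add_right inner_commute algebra_simps)
    then show "poly (\<Sum>b\<le>2 * Suc j. monom (real (2 * Suc j choose b) *
        sphere_mean (\<lambda>z. (v \<bullet> z) ^ (2 * Suc j - b) * (w \<bullet> z) ^ b)) b) e =
        poly (smult M ([:v \<bullet> v, 2 * (v \<bullet> w), w \<bullet> w:] ^ Suc j)) e"
      using sphere_mean_binomial[of "\<lambda>_. 1" v e w "2 * Suc j"] M[of "v + e *\<^sub>R w"]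
      by (simp add: poly_power del: power_Suc mult_Suc_right)
  qed
  have "real (2 * Suc j) * sphere_mean (\<lambda>z. (v \<bullet> z) ^ (2 * j + 1) * (w \<bullet> z)) =
      M * (real (Suc j) * (v \<bullet> v) ^ j * (2 * (v \<bullet> w)))"
    using arg_cong[OF poly_eq[of w], of "\<lambda>p. coeff p 1"]
    unfolding coeff_sum_monom coeff_smult coeff_quadratic_power by simp
  then have "real (2 * Suc j) * sphere_mean (\<lambda>z. (v \<bullet> z) ^ (2 * j + 1) * (w \<bullet> z)) =
      real (2 * Suc j) * (M * (v \<bullet> v) ^ j * (v \<bullet> w))"
    by (simp add: algebra_simps)
  then have first: "sphere_mean (\<lambda>z. (v \<bullet> z) ^ (2 * j + 1) * (w \<bullet> z)) = M * (v \<bullet> v) ^ j * (v \<bullet> w)"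
    by (subst (asm) mult_left_cancel) simp_all
  have second: "real (2 * Suc j choose 2) * sphere_mean (\<lambda>z. (v \<bullet> z) ^ (2 * j) * (e \<bullet> z) ^ 2) =
      M * (real (Suc j) * (v \<bullet> v) ^ j * (e \<bullet> e) +
        2 * real (Suc j) * real j * (v \<bullet> v) ^ (j - 1) * (v \<bullet> e) ^ 2)" for e
    using arg_cong[OF poly_eq[of e], of "\<lambda>p. coeff p 2"]
    unfolding coeff_sum_monom coeff_smult coeff_quadratic_power by (simp add: power_mult_distrib)
  have norm: "x \<bullet> x = (\<Sum>e\<in>Basis. (e \<bullet> x) ^ 2)" for x :: "real ^ 'n"
    by (subst euclidean_inner) (simp add: power2_eq_square inner_commute)
  have "sphere_mean (\<lambda>z. (v \<bullet> z) ^ (2 * j)) =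
      sphere_mean (\<lambda>z. \<Sum>e\<in>Basis. (v \<bullet> z) ^ (2 * j) * (e \<bullet> z) ^ 2)"
    by (rule sphere_mean_cong)
      (simp add: sum_distrib_left[symmetric] norm[symmetric] dot_square_norm)
  also have "\<dots> = (\<Sum>e\<in>Basis. sphere_mean (\<lambda>z. (v \<bullet> z) ^ (2 * j) * (e \<bullet> z) ^ 2))"
    by (intro sphere_mean_sum continuous_intros)
  finally have "real (2 * Suc j choose 2) * sphere_mean (\<lambda>z. (v \<bullet> z) ^ (2 * j)) =
      (\<Sum>e\<in>Basis. M * (real (Suc j) * (v \<bullet> v) ^ j * (e \<bullet> e) +
        2 * real (Suc j) * real j * (v \<bullet> v) ^ (j - 1) * (v \<bullet> e) ^ 2))"
    by (simp only: sum_distrib_left second)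
  also have "\<dots> = M * (real (Suc j) * (v \<bullet> v) ^ j * real CARD('n) +
      2 * real (Suc j) * real j * (v \<bullet> v) ^ (j - 1) * (v \<bullet> v))"
    unfolding norm[of v]
    by (simp add: norm[symmetric] sum_distrib_left[symmetric] sum_distrib_right[symmetric]
        sum.distrib inner_same_Basis inner_commute algebra_simps)
  also have "2 * real (Suc j) * real j * (v \<bullet> v) ^ (j - 1) * (v \<bullet> v) = 2 * real (Suc j) * real j * (v \<bullet> v) ^ j"
    by (cases j) simp_all
  also have "real (2 * Suc j choose 2) = real (Suc j) * real (2 * j + 1)"
    by (simp add: choose_two field_simps)
  finally have "real (Suc j) * (real (2 * j + 1) * sphere_mean (\<lambda>z. (v \<bullet> z) ^ (2 * j))) =
      real (Suc j) * (M * (v \<bullet> v) ^ j * (real CARD('n) + 2 * real j))"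
    by (simp add: algebra_simps)
  then have "real (2 * j + 1) * sphere_mean (\<lambda>z. (v \<bullet> z) ^ (2 * j)) =
      M * (v \<bullet> v) ^ j * (real CARD('n) + 2 * real j)"
    by (subst (asm) mult_left_cancel) simp_all
  from arg_cong[OF this, of "\<lambda>r. (v \<bullet> w) * r"] show ?thesis
    unfolding first by (simp only: mult_ac)
qed

text \<open>
  The previous identity for the vectors v = x + e y and w = x, compared at $e^b$.  When a + b is even
  all three means vanish, since the integrands are odd.  For a = 0 or b = 0 the truncated exponents
  are harmless: the factor in front of the mean is zero.
\<close>

lemma sphere_mean_two_powers:
  fixes x y :: "real ^ 'n::finite"
  assumes x: "norm x = 1"
  shows "(real CARD('n) + real a + real b - 1) * sphere_mean (\<lambda>z. (x \<bullet> z) ^ Suc a * (y \<bullet> z) ^ b) =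
    real a * sphere_mean (\<lambda>z. (x \<bullet> z) ^ (a - 1) * (y \<bullet> z) ^ b) +
    real b * (x \<bullet> y) * sphere_mean (\<lambda>z. (x \<bullet> z) ^ a * (y \<bullet> z) ^ (b - 1))"
proof (cases "odd (a + b)")
  case False
  have odd: "sphere_mean (\<lambda>z. (x \<bullet> z) ^ k * (y \<bullet> z) ^ l) = 0" if "odd (k + l)" for k l
    using that by (intro sphere_mean_odd continuous_intros)
      (auto simp: inner_minus_right power_minus[of "x \<bullet> _"] power_minus[of "y \<bullet> _"] uminus_power_if)
  have "a = 0 \<or> odd (a - 1 + b)" "b = 0 \<or> odd (a + (b - 1))"
    using False by presburger+
  then show ?thesis
    using odd[of "Suc a" b] odd[of "a - 1" b] odd[of a "b - 1"] False by auto
next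
  case True
  then obtain j where j: "a + b = 2 * j + 1"
    using oddE by blast
  let ?L = "\<lambda>k l. sphere_mean (\<lambda>z. (x \<bullet> z) ^ k * (y \<bullet> z) ^ l)"
  let ?N = "real CARD('n) + 2 * real j"
  have "smult ?N (\<Sum>b\<le>2 * j + 1. monom (real (2 * j + 1 choose b) *
      sphere_mean (\<lambda>z. (x \<bullet> z) ^ (2 * j + 1 - b) * (y \<bullet> z) ^ b * (x \<bullet> z))) b) =
      smult (real (2 * j + 1)) ([:1, x \<bullet> y:] * (\<Sum>b\<le>2 * j. monom (real (2 * j choose b) *
        sphere_mean (\<lambda>z. (x \<bullet> z) ^ (2 * j - b) * (y \<bullet> z) ^ b * 1)) b))" (is "?l = ?r")
  proof (rule poly_eq_poly_eq_iff[THEN iffD1], rule ext)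
    fix e :: real
    have "(x + e *\<^sub>R y) \<bullet> x = poly [:1, x \<bullet> y:] e"
      using x by (simp add: inner_add_left inner_commute[of y] dot_square_norm)
    moreover have "continuous_on UNIV (\<lambda>z. x \<bullet> z)"
      by (intro continuous_intros)
    ultimately show "poly ?l e = poly ?r e"
      using sphere_mean_linear_power_inner[of j "x + e *\<^sub>R y" x]
        sphere_mean_binomial[of "\<lambda>z. x \<bullet> z" x e y "2 * j + 1"]
        sphere_mean_binomial[of "\<lambda>_. 1" x e y "2 * j"]
      unfolding poly_smult poly_mult by (simp only: mult_1_right continuous_on_const mult.assoc)
  qed
  note poly_eq = this
  have coeff_r: "coeff ([:1, u:] * r) b = coeff r b + u * (if b = 0 then 0 else coeff r (b - 1))"
    for u :: real and r
    by (cases b) simp_all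
  have Xpow: "(x \<bullet> z) ^ (2 * j + 1 - b) * (y \<bullet> z) ^ b * (x \<bullet> z) = (x \<bullet> z) ^ Suc a * (y \<bullet> z) ^ b" for z
  proof -
    have "2 * j + 1 - b = a" using j by simp
    then show ?thesis by (simp add: mult_ac)
  qed
  have coeff: "?N * (real (2 * j + 1 choose b) * ?L (Suc a) b) =
      real (2 * j + 1) * ((if b \<le> 2 * j then real (2 * j choose b) * ?L (2 * j - b) b else 0) +
        (x \<bullet> y) * (if b = 0 then 0 else real (2 * j choose (b - 1)) * ?L (2 * j - (b - 1)) (b - 1)))"
    using arg_cong[OF poly_eq, of "\<lambda>p. coeff p b"] j
    unfolding coeff_smult coeff_r coeff_sum_monom Xpow mult_1_right by (simp add: mult_ac)
  have first: "real (2 * j + 1) * (if b \<le> 2 * j then real (2 * j choose b) * ?L (2 * j - b) b else 0) =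
      real (2 * j + 1 choose b) * (real a * ?L (a - 1) b)"
  proof (cases "b \<le> 2 * j")
    case True
    then have "real (2 * j + 1) * real (2 * j choose b) = real a * real (2 * j + 1 choose b)"
    proof -
      have "2 * j + 1 - b = a" using j by simp
      with binomial_absorb_comp[of "2 * j + 1" b]
      have "a * (2 * j + 1 choose b) = (2 * j + 1) * (2 * j choose b)" by simp
      then show ?thesis by (metis of_nat_mult)
    qed
    moreover have "2 * j - b = a - 1"
      using j by simp
    ultimately show ?thesis
      using True by simp
  qed (use j in simp)
  have second: "real (2 * j + 1) * ((x \<bullet> y) * (if b = 0 then 0 else
        real (2 * j choose (b - 1)) * ?L (2 * j - (b - 1)) (b - 1))) =
      real (2 * j + 1 choose b) * (real b * (x \<bullet> y) * ?L a (b - 1))"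
  proof (cases "b = 0")
    case False
    then have "real (2 * j + 1) * real (2 * j choose (b - 1)) = real b * real (2 * j + 1 choose b)"
    proof -
      have "b * (2 * j + 1 choose b) = (2 * j + 1) * (2 * j choose (b - 1))"
        using times_binomial_minus1_eq[of b "2 * j + 1"] False by simp
      then show ?thesis by (metis of_nat_mult)
    qed
    moreover have "2 * j - (b - 1) = a"
      using j False by simp
    ultimately show ?thesis
      using False by simp
  qed simp
  have eq: "real (2 * j + 1 choose b) * (?N * ?L (Suc a) b) =
      real (2 * j + 1 choose b) * (real a * ?L (a - 1) b + real b * (x \<bullet> y) * ?L a (b - 1))"
    using coeff unfolding distrib_left[of "real (2 * j + 1)"] first second by (simp add: algebra_simps)
  have nonzero: "real (2 * j + 1 choose b) \<noteq> 0"
    using j by (simp add: binomial_eq_0_iff)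
  have N: "?N = real CARD('n) + real a + real b - 1"
    using arg_cong[OF j, of real] by simp
  show ?thesis
    using eq[unfolded mult_left_cancel[OF nonzero]] unfolding N .
qed

section \<open>Means of products of zonal functions\<close>

definition zonal_mean :: "real ^ 'n::finite \<Rightarrow> real ^ 'n \<Rightarrow> real poly \<Rightarrow> real poly \<Rightarrow> real" where
  "zonal_mean x y p q = sphere_mean (\<lambda>z. poly p (x \<bullet> z) * poly q (y \<bullet> z))"

lemma continuous_poly_inner [continuous_intros]:
  "continuous_on A (\<lambda>z :: 'a::real_inner. poly p (x \<bullet> z))"
  by (intro continuous_on_poly continuous_intros)

lemma zonal_mean_commute: "zonal_mean x y p q = zonal_mean y x q p"
  by (simp add: zonal_mean_def mult.commute)

lemma zonal_mean_add_left: "zonal_mean x y (p + p') q = zonal_mean x y p q + zonal_mean x y p' q"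
  unfolding zonal_mean_def
  by (subst sphere_mean_add[symmetric]) (auto intro!: continuous_intros simp: algebra_simps)

lemma zonal_mean_smult_left: "zonal_mean x y (smult c p) q = c * zonal_mean x y p q"
  unfolding zonal_mean_def
  by (subst sphere_mean_cmult[symmetric]) (auto intro!: continuous_intros simp: algebra_simps)

lemma zonal_mean_add_right: "zonal_mean x y p (q + q') = zonal_mean x y p q + zonal_mean x y p q'"
  using zonal_mean_add_left[of y x q q' p] by (simp add: zonal_mean_commute)

lemma zonal_mean_smult_right: "zonal_mean x y p (smult c q) = c * zonal_mean x y p q"
  using zonal_mean_smult_left[of y x c q p] by (simp add: zonal_mean_commute)

lemma zonal_mean_diff_left: "zonal_mean x y (p - p') q = zonal_mean x y p q - zonal_mean x y p' q"
  using zonal_mean_add_left[of x y p "smult (-1) p'" q] zonal_mean_smult_left[of x y "-1" p' q] by simp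

lemma zonal_mean_diff_right: "zonal_mean x y p (q - q') = zonal_mean x y p q - zonal_mean x y p q'"
  using zonal_mean_diff_left[of y x q q' p] by (simp add: zonal_mean_commute)

lemmas zonal_mean_linear = zonal_mean_add_left zonal_mean_add_right zonal_mean_diff_left
  zonal_mean_diff_right zonal_mean_smult_left zonal_mean_smult_right

lemma zonal_mean_shift_add:
  "zonal_mean x y (pCons 0 (p + p')) q = zonal_mean x y (pCons 0 p) q + zonal_mean x y (pCons 0 p') q"
  "zonal_mean x y p (pCons 0 (q + q')) = zonal_mean x y p (pCons 0 q) + zonal_mean x y p (pCons 0 q')"
  "zonal_mean x y (pCons 0 (pCons 0 (p + p'))) q =
    zonal_mean x y (pCons 0 (pCons 0 p)) q + zonal_mean x y (pCons 0 (pCons 0 p')) q"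
  by (simp_all flip: zonal_mean_add_left zonal_mean_add_right)

lemma zonal_mean_zero [simp]: "zonal_mean x y 0 q = 0" "zonal_mean x y p 0 = 0"
  using zonal_mean_smult_left[of x y 0] zonal_mean_smult_right[of x y _ 0] by simp_all

lemma poly_induct_monom [case_names monom add]:
  assumes monom: "\<And>c k. P (monom c k)" and add: "\<And>p q. P p \<Longrightarrow> P q \<Longrightarrow> P (p + q)"
  shows "P p"
proof -
  have "P (\<Sum>i\<le>d. monom (coeff p i) i)" for d
    by (induction d) (auto intro: monom add)
  from this[of "degree p"] show ?thesis
    by (simp add: poly_as_sum_of_monoms)
qed

lemma zonal_mean_monom:
  "zonal_mean x y (monom c a) (monom d b) = c * d * sphere_mean (\<lambda>z. (x \<bullet> z) ^ a * (y \<bullet> z) ^ b)"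
  unfolding zonal_mean_def
  by (subst sphere_mean_cmult[symmetric]) (auto intro!: continuous_intros simp: poly_monom algebra_simps)

text \<open>
  Integration by parts on the sphere: the tangential divergence of a function times the tangential
  part of the constant vector field x.
\<close>

lemma zonal_mean_parts:
  fixes x y :: "real ^ 'n::finite"
  assumes x: "norm x = 1"
  shows "zonal_mean x y (pderiv p) q - zonal_mean x y (pCons 0 (pCons 0 (pderiv p))) q
      + (x \<bullet> y) * zonal_mean x y p (pderiv q) - zonal_mean x y (pCons 0 p) (pCons 0 (pderiv q)) =
    (real CARD('n) - 1) * zonal_mean x y (pCons 0 p) q"
proof (induction p rule: poly_induct_monom)
  case (monom c a)
  show ?case
  proof (induction q rule: poly_induct_monom)
    case (monom d b)
    have 1: "pCons 0 (pCons 0 (pderiv (monom c a))) = monom (real a * c) (Suc a)"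
      by (cases a) (simp_all add: pderiv_monom flip: monom_Suc)
    have 2: "pCons 0 (pderiv (monom d b)) = monom (real b * d) b"
      by (cases b) (simp_all add: pderiv_monom flip: monom_Suc)
    show ?case
      unfolding 1 2 unfolding monom_Suc[symmetric] pderiv_monom zonal_mean_monom
      using arg_cong[OF sphere_mean_two_powers[OF x, of a b y], of "\<lambda>r. c * d * r"]
      by (simp add: algebra_simps)
  next
    case (add q q')
    then show ?case
      by (simp add: pderiv_add zonal_mean_shift_add zonal_mean_linear algebra_simps)
  qed
next
  case (add p p')
  then show ?case
    by (simp add: pderiv_add zonal_mean_shift_add zonal_mean_linear algebra_simps)
qed

section \<open>Gegenbauer polynomials\<close>

text \<open>
  In standard notation this is $C_{k-1}^{(n/2)}$.  The shift provides $C_{-1} = 0$ at the index 0, and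
  most recurrences then hold at the boundary as well.
\<close>

fun gegenbauer :: "nat \<Rightarrow> nat \<Rightarrow> real poly" where
  "gegenbauer n 0 = 0"
| "gegenbauer n (Suc 0) = 1"
| "gegenbauer n (Suc (Suc k)) = smult (1 / (real k + 1))
     (smult (2 * real k + real n) (pCons 0 (gegenbauer n (Suc k))) -
      smult (real k + real n - 1) (gegenbauer n k))"

text \<open>
  The polynomial $C_k^{(n/2)} - C_{k-2}^{(n/2)}$, a coefficient of the Poisson kernel
  $(1 - r^2) / (1 - 2 u r + r^2)^{n/2}$.  It is a multiple of $C_k^{(n/2-1)}$, but the difference also makes
  sense for n = 2.  For k = 0 the truncated subtraction reads off $C_{-1} = 0$.
\<close>

definition zonal :: "nat \<Rightarrow> nat \<Rightarrow> real poly" where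
  "zonal n k = gegenbauer n (k + 1) - gegenbauer n (k - 1)"

text \<open>
  The coefficients of the three-term recurrence for multiplication by the variable.  The general
  formula for the lower coefficient at k = 1 is the fraction 0 / 0 if n = 2, hence the separate value.
\<close>

definition up_coeff :: "nat \<Rightarrow> nat \<Rightarrow> real" where
  "up_coeff n k = (real k + 1) / (real n + 2 * real k)"

definition down_coeff :: "nat \<Rightarrow> nat \<Rightarrow> real" where
  "down_coeff n k = (if k = 0 then 0 else if k = 1 then 1
     else (real n + real k - 3) / (real n + 2 * real k - 4))"

lemma real_poly_ext: "(\<And>u. poly p u = poly q u) \<Longrightarrow> p = (q :: real poly)"
  by (simp add: poly_eq_poly_eq_iff[symmetric] fun_eq_iff)

lemma gegenbauer_rec:
  "(2 * real k + real n - 2) * (u * poly (gegenbauer n k) u) =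
    real k * poly (gegenbauer n (k + 1)) u + (real k + real n - 2) * poly (gegenbauer n (k - 1)) u"
  by (cases k) (simp_all add: field_simps)

text \<open>
  The two identities need each other in the induction: the first at k gives, through the derivative of
  the recurrence, the difference of the derivatives at k + 2 and at k, from which both follow at k + 1.
\<close>

lemma gegenbauer_deriv:
  "u * poly (pderiv (gegenbauer n (Suc k))) u =
     real k * poly (gegenbauer n (Suc k)) u + poly (pderiv (gegenbauer n k)) u"
  "poly (pderiv (gegenbauer n (Suc k))) u =
     u * poly (pderiv (gegenbauer n k)) u + (real k + real n - 1) * poly (gegenbauer n k) u"
proof (induction k)
  case 0
  {
    case 1
    show ?case by simp
  next
    case 2
    show ?case by simp
  }
next
  case (Suc k)
  let ?G = "\<lambda>k. poly (gegenbauer n k) u" and ?D = "\<lambda>k. poly (pderiv (gegenbauer n k)) u"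
  have rec: "(real k + 1) * ?G (Suc (Suc k)) = (2 * real k + real n) * (u * ?G (Suc k)) - (real k + real n - 1) * ?G k"
    by (simp add: field_simps)
  have "(real k + 1) * ?D (Suc (Suc k)) =
      (2 * real k + real n) * (?G (Suc k) + u * ?D (Suc k)) - (real k + real n - 1) * ?D k"
    by (simp add: pderiv_smult pderiv_diff pderiv_pCons field_simps)
  also have "\<dots> = (real k + 1) * ((2 * real k + real n) * ?G (Suc k) + ?D k)"
    unfolding Suc(1) by (simp add: algebra_simps)
  finally have D: "?D (Suc (Suc k)) = (2 * real k + real n) * ?G (Suc k) + ?D k"
    by simp
  {
    case 1
    show ?case
      using rec Suc(2) unfolding D by (simp add: algebra_simps del: gegenbauer.simps)
  next
    case 2
    show ?case
      using Suc(1) unfolding D by (simp add: algebra_simps del: gegenbauer.simps)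
  }
qed

lemma zonal_0 [simp]: "zonal n 0 = 1"
  by (simp add: zonal_def)

lemma zonal_1: "zonal n (Suc 0) = [:0, real n:]"
  by (simp add: zonal_def one_pCons)

text \<open>
  Read as a recursion, this makes every Gegenbauer polynomial a sum of zonal polynomials of lower
  degree and of one parity.
\<close>

lemma gegenbauer_zonal: "gegenbauer n (Suc (Suc k)) = zonal n (Suc k) + gegenbauer n k"
  by (simp add: zonal_def)

lemma pderiv_zonal: "pderiv (zonal n k) = smult (2 * real k + real n - 2) (gegenbauer n k)"
proof (cases k)
  case (Suc k')
  show ?thesis
  proof (rule real_poly_ext)
    fix u
    show "poly (pderiv (zonal n k)) u = poly (smult (2 * real k + real n - 2) (gegenbauer n k)) u"
      using gegenbauer_deriv(2)[of n k u] gegenbauer_deriv(1)[of u n k'] Suc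
      by (simp add: zonal_def pderiv_diff algebra_simps del: gegenbauer.simps)
  qed
qed (simp add: zonal_def)

lemma zonal_mult_deriv:
  "pCons 0 (pderiv (zonal n k)) =
    smult (real k) (zonal n k) + smult (2 * real k + real n - 2) (gegenbauer n (k - 1))"
proof (rule real_poly_ext)
  fix u
  show "poly (pCons 0 (pderiv (zonal n k))) u = poly (smult (real k) (zonal n k) +
      smult (2 * real k + real n - 2) (gegenbauer n (k - 1))) u"
    using gegenbauer_rec[of k n u] unfolding pderiv_zonal
    by (simp add: zonal_def algebra_simps del: gegenbauer.simps)
qed

lemma gegenbauer_mult_low:
  assumes "n \<ge> 1" "k \<ge> 1"
  shows "poly (gegenbauer n k) u - u * poly (gegenbauer n (k - 1)) u = down_coeff n k * poly (zonal n (k - 1)) u"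
proof (cases "k = 1")
  case True
  then show ?thesis by (simp add: down_coeff_def)
next
  case False
  then have k: "k \<ge> 2" using assms by simp
  let ?d = "real n + 2 * real k - 4"
  have d: "?d > 0" using assms k by linarith
  have "?d * (poly (gegenbauer n k) u - u * poly (gegenbauer n (k - 1)) u) =
      (real n + real k - 3) * poly (zonal n (k - 1)) u"
    using gegenbauer_rec[of "k - 1" n u] k
    by (simp add: zonal_def algebra_simps of_nat_diff numeral_2_eq_2 del: gegenbauer.simps)
  then show ?thesis
    using d False k by (simp add: down_coeff_def field_simps)
qed

lemma zonal_mult:
  assumes n: "n \<ge> 1"
  shows "pCons 0 (zonal n k) = smult (up_coeff n k) (zonal n (k + 1)) + smult (down_coeff n k) (zonal n (k - 1))"
proof (rule real_poly_ext)
  fix u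
  have d: "real n + 2 * real k > 0" using n by simp
  have up: "u * poly (gegenbauer n (k + 1)) u =
      up_coeff n k * poly (zonal n (k + 1)) u + poly (gegenbauer n k) u"
    using gegenbauer_rec[of "k + 1" n u] d
    by (simp add: zonal_def up_coeff_def field_simps del: gegenbauer.simps)
  show "poly (pCons 0 (zonal n k)) u =
      poly (smult (up_coeff n k) (zonal n (k + 1)) + smult (down_coeff n k) (zonal n (k - 1))) u"
  proof (cases "k = 0")
    case True
    then show ?thesis using up by (simp add: down_coeff_def)
  next
    case False
    then show ?thesis
      using up gegenbauer_mult_low[OF n, of k u]
      by (simp add: zonal_def[of n k] algebra_simps del: gegenbauer.simps)
  qed
qed

text \<open>
  The left-hand side is $(1 - u^2) Q_k'(u)$, the expression in which the derivative enters
  zonal_mean_parts.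
\<close>

lemma zonal_deriv_weighted:
  assumes n: "n \<ge> 1"
  shows "pderiv (zonal n k) - pCons 0 (pCons 0 (pderiv (zonal n k))) =
    smult ((2 * real k + real n - 2) * down_coeff n k) (zonal n (k - 1)) - smult (real k) (pCons 0 (zonal n k))"
proof (cases "k = 0")
  case False
  show ?thesis
  proof (rule real_poly_ext)
    fix u
    have "poly (pderiv (zonal n k) - pCons 0 (pCons 0 (pderiv (zonal n k)))) u =
        (2 * real k + real n - 2) * (poly (gegenbauer n k) u - u * poly (gegenbauer n (k - 1)) u) -
        real k * (u * poly (zonal n k) u)"
      by (subst zonal_mult_deriv) (simp add: pderiv_zonal algebra_simps del: gegenbauer.simps)
    then show "poly (pderiv (zonal n k) - pCons 0 (pCons 0 (pderiv (zonal n k)))) u =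
        poly (smult ((2 * real k + real n - 2) * down_coeff n k) (zonal n (k - 1)) -
          smult (real k) (pCons 0 (zonal n k))) u"
      using False gegenbauer_mult_low[OF n, of k u] by simp
  qed
qed (simp add: down_coeff_def)

lemma degree_gegenbauer: "degree (gegenbauer n k) \<le> k - 1"
proof (induction n k rule: gegenbauer.induct)
  case (3 n k)
  then show ?case
    by (auto intro!: degree_diff_le degree_smult_le[THEN order_trans] degree_pCons_le[THEN order_trans])
qed simp_all

lemma degree_zonal: "degree (zonal n k) \<le> k"
  unfolding zonal_def using degree_gegenbauer[of n "k + 1"] degree_gegenbauer[of n "k - 1"]
  by (intro degree_diff_le) auto

lemma poly_gegenbauer_uminus: "poly (gegenbauer n k) (- u) = - ((- 1) ^ k) * poly (gegenbauer n k) u"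
  by (induction n k rule: gegenbauer.induct) (simp_all add: algebra_simps)

lemma poly_zonal_uminus: "poly (zonal n k) (- u) = (- 1) ^ k * poly (zonal n k) u"
  by (cases k) (simp_all add: zonal_def poly_gegenbauer_uminus algebra_simps del: gegenbauer.simps(3))

lemma gegenbauer_one_ratio:
  "(real k + 1) * poly (gegenbauer n (Suc (Suc k))) 1 = (real n + real k) * poly (gegenbauer n (Suc k)) 1"
proof (induction k)
  case (Suc k)
  have "(real k + 2) * poly (gegenbauer n (Suc (Suc (Suc k)))) 1 =
      (2 * real k + 2 + real n) * poly (gegenbauer n (Suc (Suc k))) 1 -
      (real k + real n) * poly (gegenbauer n (Suc k)) 1"
    using gegenbauer_rec[of "Suc (Suc k)" n 1] by (simp add: algebra_simps del: gegenbauer.simps)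
  with Suc show ?case
    by (simp add: algebra_simps del: gegenbauer.simps)
qed simp

lemma gegenbauer_one:
  assumes n: "n \<ge> 1"
  shows "poly (gegenbauer n (Suc k)) 1 = real ((n + k - 1) choose k)"
proof (induction k)
  case (Suc k)
  have "(real k + 1) * poly (gegenbauer n (Suc (Suc k))) 1 = (real n + real k) * real ((n + k - 1) choose k)"
    using gegenbauer_one_ratio[of k n] Suc by simp
  also have "\<dots> = real ((n + k) * ((n + k - 1) choose k))"
    by simp
  also have "(n + k) * ((n + k - 1) choose k) = Suc k * ((n + k) choose Suc k)"
    using Suc_times_binomial_eq[of "n + k - 1" k] n by (simp add: mult.commute)
  also have "real (Suc k * ((n + k) choose Suc k)) = (real k + 1) * real ((n + Suc k - 1) choose Suc k)"
    by (simp add: algebra_simps)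
  finally show ?case
    by (subst (asm) mult_left_cancel) simp_all
qed simp

lemma one_minus_up_coeff:
  assumes "n \<ge> 1"
  shows "1 - up_coeff n k = down_coeff n (Suc (Suc k))"
  using assms by (simp add: up_coeff_def down_coeff_def field_simps)

text \<open>
  The number $Q_k(1)$ is the dimension of the space of harmonics of degree k.  The relation between
  consecutive dimensions follows inductively from the three-term recurrence at 1, because
  up_coeff n k and down_coeff n (k + 2) add up to 1.
\<close>

lemma zonal_one_step:
  assumes n: "n \<ge> 1"
  shows "up_coeff n k * poly (zonal n (Suc k)) 1 = down_coeff n (Suc k) * poly (zonal n k) 1"
proof (induction k)
  case 0
  show ?case using n by (simp add: up_coeff_def down_coeff_def zonal_1)
next
  case (Suc k)
  have "poly (zonal n (Suc k)) 1 = up_coeff n (Suc k) * poly (zonal n (Suc (Suc k))) 1 +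
      down_coeff n (Suc k) * poly (zonal n k) 1"
    using arg_cong[OF zonal_mult[OF n, of "Suc k"], of "\<lambda>p. poly p 1"] by simp
  then have "up_coeff n (Suc k) * poly (zonal n (Suc (Suc k))) 1 = (1 - up_coeff n k) * poly (zonal n (Suc k)) 1"
    unfolding Suc[symmetric] by (simp add: algebra_simps)
  also have "1 - up_coeff n k = down_coeff n (Suc (Suc k))"
    by (rule one_minus_up_coeff[OF n])
  finally show ?case .
qed

lemma up_coeff_pos: "n \<ge> 1 \<Longrightarrow> up_coeff n k > 0"
  by (simp add: up_coeff_def)

lemma down_coeff_pos: "n \<ge> 2 \<Longrightarrow> down_coeff n (Suc k) > 0"
  by (cases k) (simp_all add: down_coeff_def)

lemma zonal_one_pos:
  assumes n: "n \<ge> 2"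
  shows "poly (zonal n k) 1 > 0"
proof (induction k)
  case (Suc k)
  have "up_coeff n k * poly (zonal n (Suc k)) 1 > 0"
    using n zonal_one_step[of n k] down_coeff_pos[OF n, of k] Suc by simp
  then show ?case
    using up_coeff_pos[of n k] n by (simp add: zero_less_mult_iff)
qed simp

lemma zonal_one_closed:
  assumes n: "n \<ge> 2"
  shows "poly (zonal n k) 1 * down_coeff n (Suc k) * fact k * fact (n - 2) = fact (n + k - 2)"
proof (induction k)
  case 0
  show ?case by (simp add: down_coeff_def)
next
  case (Suc k)
  have up: "up_coeff n k * (real n + 2 * real k) = real k + 1"
    using n by (simp add: up_coeff_def)
  have down: "down_coeff n (Suc (Suc k)) * (real n + 2 * real k) = real n + real k - 1"
    using n by (simp add: down_coeff_def field_simps)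
  have "up_coeff n k * (real n + 2 * real k) *
      (poly (zonal n (Suc k)) 1 * down_coeff n (Suc (Suc k)) * fact (Suc k) * fact (n - 2)) =
      (up_coeff n k * poly (zonal n (Suc k)) 1) * fact k * fact (n - 2) * (real k + 1) *
      (down_coeff n (Suc (Suc k)) * (real n + 2 * real k))"
    by (simp add: algebra_simps)
  also have "\<dots> = (real k + 1) * (fact (n + k - 2) * (real n + real k - 1))"
    using n unfolding down by (subst zonal_one_step) (simp_all add: Suc[symmetric])
  also have "fact (n + k - 2) * (real n + real k - 1) = fact (n + Suc k - 2)"
  proof -
    obtain m where "n = 2 + m"
      using n le_Suc_ex by blast
    then show ?thesis
      by (simp add: algebra_simps)
  qed
  finally show ?case
    unfolding up by (subst (asm) mult_left_cancel) simp_all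
qed

lemma gegenbauer_sum:
  "gegenbauer n m = (\<Sum>k | k < m \<and> odd (m + k). zonal n k)"
proof (induction n m rule: gegenbauer.induct)
  case (2 n)
  have "{k. k < Suc 0 \<and> odd (Suc 0 + k)} = {0}" by auto
  then show ?case by simp
next
  case (3 n m)
  have "{k. k < Suc (Suc m) \<and> odd (Suc (Suc m) + k)} = insert (Suc m) {k. k < m \<and> odd (m + k)}"
    by (auto simp: less_Suc_eq)
  then show ?case
    using 3(2) by (simp add: gegenbauer_zonal del: gegenbauer.simps)
qed simp

lemma gegenbauer_one_ibinom:
  assumes "n \<ge> 1"
  shows "poly (gegenbauer n m) 1 = ibinom (int n + int m - 2) (int m - 1)"
proof (cases m)
  case (Suc k)
  have eq: "real_of_int (int n + int k - 1) = real (n + k - 1)"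
    using assms by simp
  have "int n + int m - 2 = int n + int k - 1" "int m - 1 = int k"
    using Suc by simp_all
  then have "ibinom (int n + int m - 2) (int m - 1) = real_of_int (int n + int k - 1) gchoose k"
    by (simp only: ibinom_def nat_int) simp
  also have "\<dots> = real ((n + k - 1) choose k)"
    unfolding eq by (rule binomial_gbinomial[symmetric])
  finally show ?thesis
    using gegenbauer_one[OF assms, of k] Suc by (simp only:)
qed (simp add: ibinom_def)

lemma gegenbauer_one_closed:
  assumes "n \<ge> 1"
  shows "poly (gegenbauer n m) 1 * fact m * fact (n - 1) = real m * fact (n + m - 2)"
proof (cases m)
  case (Suc k)
  have "fact k * fact (n - 1) * ((n + k - 1) choose k) = fact (n + k - 1)"
    using binomial_fact_lemma[of k "n + k - 1"] assms by simp
  from arg_cong[OF this, of real]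
  have "fact k * fact (n - 1) * real ((n + k - 1) choose k) = fact (n + k - 1)"
    by (simp only: of_nat_mult of_nat_fact)
  then show ?thesis
    using gegenbauer_one[OF assms, of k] Suc by (simp add: mult_ac)
qed simp

section \<open>Orthogonality of zonal polynomials\<close>

text \<open>
  Integration by parts for two zonal polynomials, with the derivatives eliminated.  The means on the
  right either have a smaller first degree or a second factor of smaller degree.
\<close>

lemma zonal_mean_mult_zonal:
  fixes x y :: "real ^ 'n::finite"
  defines "n \<equiv> CARD('n)"
  assumes x: "norm x = 1"
  shows "(real n + real k + real l - 1) * zonal_mean x y (pCons 0 (zonal n k)) (zonal n l) =
    (2 * real k + real n - 2) * down_coeff n k * zonal_mean x y (zonal n (k - 1)) (zonal n l) +
    (2 * real l + real n - 2) * ((x \<bullet> y) * zonal_mean x y (zonal n k) (gegenbauer n l) -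
      zonal_mean x y (pCons 0 (zonal n k)) (gegenbauer n (l - 1)))"
proof -
  have n: "n \<ge> 1" by (simp add: n_def Suc_le_eq)
  have "zonal_mean x y (pderiv (zonal n k) - pCons 0 (pCons 0 (pderiv (zonal n k)))) (zonal n l)
      + (x \<bullet> y) * zonal_mean x y (zonal n k) (pderiv (zonal n l))
      - zonal_mean x y (pCons 0 (zonal n k)) (pCons 0 (pderiv (zonal n l))) =
      (real n - 1) * zonal_mean x y (pCons 0 (zonal n k)) (zonal n l)"
    using zonal_mean_parts[OF x, of y "zonal n k" "zonal n l"]
    by (simp only: zonal_mean_diff_left n_def)
  then show ?thesis
    unfolding zonal_deriv_weighted[OF n] unfolding zonal_mult_deriv
    unfolding pderiv_zonal zonal_mean_linear
    by (simp add: algebra_simps)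
qed

text \<open>
  The addition formula in the form of a reproducing property.  The proof is an induction on k, and for
  fixed k + 1 on l: zonal_mean_mult_zonal expresses the mean for (k + 1, l) through means
  that are already known, and $u Q_k(u)$ cancels against them by the three-term recurrence.  The
  induction divides by n + k + l - 1, which is positive for n at least 2.
\<close>

theorem zonal_mean_zonal:
  fixes x y :: "real ^ 'n::finite"
  defines "n \<equiv> CARD('n)"
  assumes n: "n \<ge> 2" and x: "norm x = 1" and y: "norm y = 1"
  shows "zonal_mean x y (zonal n k) (zonal n l) = (if k = l then poly (zonal n k) (x \<bullet> y) else 0)"
proof -
  let ?u = "x \<bullet> y" and ?q = "\<lambda>k. poly (zonal n k) (x \<bullet> y)"
  have n1: "n \<ge> 1" using n by simp
  have mult: "zonal_mean x y (pCons 0 (zonal n k)) p =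
      up_coeff n k * zonal_mean x y (zonal n (k + 1)) p + down_coeff n k * zonal_mean x y (zonal n (k - 1)) p"
    for x y :: "real ^ 'n" and k p
    unfolding zonal_mult[OF n1] zonal_mean_linear ..
  have mult_u: "?u * ?q k = up_coeff n k * ?q (k + 1) + down_coeff n k * ?q (k - 1)" for k
    using arg_cong[OF zonal_mult[OF n1, of k], of "\<lambda>p. poly p ?u"] by simp
  have up: "up_coeff n k > 0" for k
    using n1 by (rule up_coeff_pos)
  have rel: "(real n + real k + real l - 1) * zonal_mean x y (pCons 0 (zonal n k)) (zonal n l) =
    (2 * real k + real n - 2) * down_coeff n k * zonal_mean x y (zonal n (k - 1)) (zonal n l) +
    (2 * real l + real n - 2) * (?u * zonal_mean x y (zonal n k) (gegenbauer n l) -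
      zonal_mean x y (pCons 0 (zonal n k)) (gegenbauer n (l - 1)))" for k l
    using zonal_mean_mult_zonal[OF x, of k l y] unfolding n_def .

  have base: "zonal_mean y x (zonal n k) 1 = (if k = 0 then 1 else 0)" for k
  proof (induction k rule: less_induct)
    case (less k)
    show ?case
    proof (cases k)
      case 0
      then show ?thesis by (simp add: zonal_mean_def sphere_mean_one)
    next
      case (Suc k')
      have "(real n + real k' - 1) * (up_coeff n k' * zonal_mean y x (zonal n k) 1 +
          down_coeff n k' * zonal_mean y x (zonal n (k' - 1)) 1) =
          (2 * real k' + real n - 2) * down_coeff n k' * zonal_mean y x (zonal n (k' - 1)) 1"
        using zonal_mean_mult_zonal[OF y, of k' 0 x] mult[of y x k' 1] Suc
        by (simp add: n_def[symmetric])
      moreover have "down_coeff n k' * zonal_mean y x (zonal n (k' - 1)) 1 = (if k' = 1 then 1 else 0)"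
        using less[of "k' - 1"] Suc by (auto simp: down_coeff_def)
      ultimately have "(real n + real k' - 1) * (up_coeff n k' * zonal_mean y x (zonal n k) 1) = 0"
        by (auto simp: algebra_simps split: if_splits)
      then show ?thesis
        using n up[of k'] Suc by auto
    qed
  qed

  have gegen: "zonal_mean x y (zonal n k) (gegenbauer n m) = (if k < m \<and> odd (m + k) then ?q k else 0)"
    if "\<And>l. l < m \<Longrightarrow> zonal_mean x y (zonal n k) (zonal n l) = (if k = l then ?q k else 0)" for k m
    using that
  proof (induction n m rule: gegenbauer.induct)
    case (3 n m)
    then show ?case
      unfolding gegenbauer_zonal zonal_mean_linear by (auto simp: less_Suc_eq)
  qed (use that in \<open>auto simp: n_def\<close>)

  have "\<forall>l. zonal_mean x y (zonal n k) (zonal n l) = (if k = l then ?q k else 0)"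
  proof (induction k rule: less_induct)
    case (less k)
    show ?case
    proof (cases k)
      case 0
      then show ?thesis
        using base zonal_mean_commute[of x y 1] by auto
    next
      case (Suc k')
      have prev: "zonal_mean x y (zonal n k') (zonal n l) = (if k' = l then ?q k' else 0)" for l
        using less[of k'] Suc by simp
      have prev2: "down_coeff n k' * zonal_mean x y (zonal n (k' - 1)) (zonal n l) =
          (if k' = Suc l then down_coeff n k' * ?q l else 0)" for l
        using less[of "k' - 1"] Suc by (cases k') (auto simp: down_coeff_def)
      have gegen2: "down_coeff n k' * zonal_mean x y (zonal n (k' - 1)) (gegenbauer n m) =
          (if k' \<le> m \<and> even (m + k') then down_coeff n k' * ?q (k' - 1) else 0)" for m
        using less[of "k' - 1"] Suc gegen[of m "k' - 1"]
        by (cases k') (auto simp: down_coeff_def less_eq_Suc_le)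
      show ?thesis
      proof
        fix l
        show "zonal_mean x y (zonal n k) (zonal n l) = (if k = l then ?q k else 0)"
        proof (induction l rule: less_induct)
          case (less l)
          have g: "zonal_mean x y (zonal n k) (gegenbauer n (l - 1)) =
              (if Suc k < l \<and> odd (l + k') then ?q k else 0)"
            using gegen[of "l - 1" k] less Suc by (cases l) auto
          have g2: "down_coeff n k' * zonal_mean x y (zonal n (k' - 1)) (gegenbauer n (l - 1)) =
              (if k' < l \<and> odd (l + k') then down_coeff n k' * ?q (k' - 1) else 0)"
            using gegen2[of "l - 1"] by (cases l) (auto simp: less_Suc_eq_le)
          have g1: "zonal_mean x y (zonal n k') (gegenbauer n l) = (if k' < l \<and> odd (l + k') then ?q k' else 0)"
            using gegen[of l k'] prev by simp
          have "(real n + real k' + real l - 1) * (up_coeff n k' * zonal_mean x y (zonal n k) (zonal n l) +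
              down_coeff n k' * zonal_mean x y (zonal n (k' - 1)) (zonal n l)) =
            (2 * real k' + real n - 2) * (down_coeff n k' * zonal_mean x y (zonal n (k' - 1)) (zonal n l)) +
            (2 * real l + real n - 2) * (?u * zonal_mean x y (zonal n k') (gegenbauer n l) -
              (up_coeff n k' * zonal_mean x y (zonal n k) (gegenbauer n (l - 1)) +
               down_coeff n k' * zonal_mean x y (zonal n (k' - 1)) (gegenbauer n (l - 1))))"
            using rel[of k' l] unfolding mult Suc by (simp only: mult.assoc Suc_eq_plus1)
          note main = this[unfolded prev2 g g1 g2]
          have q: "?u * ?q k' = up_coeff n k' * ?q k + down_coeff n k' * ?q (k' - 1)"
            using mult_u[of k'] Suc by simp
          have N: "real n + real k' + real l - 1 > 0"
            using n by simp
          \<comment> \<open>For odd l + k' the bracket vanishes beyond l = k, leaves the leading term at l = k, and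
            below only the mean for l = k' - 1 has to be cancelled.\<close>
          consider "even (l + k')" | "odd (l + k')" "l > Suc k" | "l = k" | "odd (l + k')" "l < k'"
            using Suc by (metis even_Suc even_add linorder_neqE_nat not_less_eq)
          then show ?case
          proof cases
            case 1
            then have "k' \<noteq> Suc l" "k \<noteq> l"
              using Suc by auto
            then show ?thesis
              using main 1 N up[of k'] by simp
          next
            case 2
            then show ?thesis
              using main q N up[of k'] Suc by simp
          next
            case 3
            have "(real n + 2 * real k') * (up_coeff n k' * zonal_mean x y (zonal n k) (zonal n l)) =
                (real n + 2 * real k') * (up_coeff n k' * ?q k)"
              using main 3 q Suc by (simp add: algebra_simps)
            then show ?thesis
              using 3 Suc up[of k'] n by simp
          next
            case 4
            then have "(real n + real k' + real l - 1) * (up_coeff n k' * zonal_mean x y (zonal n k) (zonal n l)) = 0"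
              using main Suc by (cases "k' = Suc l") (simp_all add: algebra_simps)
            then show ?thesis
              using 4 Suc N up[of k'] by simp
          qed
        qed
      qed
    qed
  qed
  then show ?thesis by blast
qed

section \<open>Polynomial functions and spherical designs\<close>

lemma poly_fun_deg_le_const: "poly_fun_deg_le t (\<lambda>x :: real ^ 'n::finite. a)"
proof -
  have "a = (\<Sum>k\<in>{k :: 'n \<Rightarrow> nat. (\<Sum>i\<in>UNIV. k i) \<le> t}. (if k = (\<lambda>_. 0) then a else 0) * (\<Prod>i\<in>UNIV. (x $ i) ^ k i))"
    for x :: "real ^ 'n"
    by (subst sum.mono_neutral_right[where S = "{\<lambda>_. 0}"]) (auto simp: finite_exponents)
  then show ?thesis
    unfolding poly_fun_deg_le_def by (intro exI[of _ "\<lambda>k. if k = (\<lambda>_. 0) then a else 0"]) blast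
qed

lemma poly_fun_deg_le_add:
  assumes "poly_fun_deg_le t f" "poly_fun_deg_le t g"
  shows "poly_fun_deg_le t (\<lambda>x. f x + g x)"
proof -
  obtain c d where "\<forall>x. f x = (\<Sum>k\<in>{k. (\<Sum>i\<in>UNIV. k i) \<le> t}. c k * (\<Prod>i\<in>UNIV. (x $ i) ^ k i))"
    and "\<forall>x. g x = (\<Sum>k\<in>{k. (\<Sum>i\<in>UNIV. k i) \<le> t}. d k * (\<Prod>i\<in>UNIV. (x $ i) ^ k i))"
    using assms unfolding poly_fun_deg_le_def by blast
  then show ?thesis
    unfolding poly_fun_deg_le_def
    by (intro exI[of _ "\<lambda>k. c k + d k"]) (simp add: sum.distrib algebra_simps)
qed

lemma poly_fun_deg_le_cmult:
  assumes "poly_fun_deg_le t f"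
  shows "poly_fun_deg_le t (\<lambda>x. a * f x)"
proof -
  obtain c where "\<forall>x. f x = (\<Sum>k\<in>{k. (\<Sum>i\<in>UNIV. k i) \<le> t}. c k * (\<Prod>i\<in>UNIV. (x $ i) ^ k i))"
    using assms unfolding poly_fun_deg_le_def by blast
  then show ?thesis
    unfolding poly_fun_deg_le_def
    by (intro exI[of _ "\<lambda>k. a * c k"]) (simp add: sum_distrib_left algebra_simps)
qed

lemma poly_fun_deg_le_sum:
  "(\<And>i. i \<in> I \<Longrightarrow> poly_fun_deg_le t (f i)) \<Longrightarrow> poly_fun_deg_le t (\<lambda>x. \<Sum>i\<in>I. f i x)"
  by (induction I rule: infinite_finite_induct) (simp_all add: poly_fun_deg_le_const poly_fun_deg_le_add)

lemma poly_fun_deg_le_mono: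
  fixes f :: "real ^ 'n::finite \<Rightarrow> real"
  assumes "poly_fun_deg_le t f" "t \<le> t'"
  shows "poly_fun_deg_le t' f"
proof -
  obtain c where c: "\<forall>x. f x = (\<Sum>k\<in>{k. (\<Sum>i\<in>UNIV. k i) \<le> t}. c k * (\<Prod>i\<in>UNIV. (x $ i) ^ k i))"
    using assms unfolding poly_fun_deg_le_def by blast
  have "f x = (\<Sum>k\<in>{k :: 'n \<Rightarrow> nat. (\<Sum>i\<in>UNIV. k i) \<le> t'}.
      (if (\<Sum>i\<in>UNIV. k i) \<le> t then c k else 0) * (\<Prod>i\<in>UNIV. (x $ i) ^ k i))" for x
    using c assms(2) by (subst sum.mono_neutral_right[where S = "{k. (\<Sum>i\<in>UNIV. k i) \<le> t}"])
      (auto simp: finite_exponents)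
  then show ?thesis
    unfolding poly_fun_deg_le_def
    by (intro exI[of _ "\<lambda>k. if (\<Sum>i\<in>UNIV. k i) \<le> t then c k else 0"]) blast
qed

text \<open>
  Multiplication by a coordinate shifts the exponents of the monomials; with sums and
  constants it generates all polynomial functions.
\<close>

lemma poly_fun_deg_le_coordinate_mult:
  fixes f :: "real ^ 'n::finite \<Rightarrow> real"
  assumes "poly_fun_deg_le t f"
  shows "poly_fun_deg_le (Suc t) (\<lambda>x. x $ i * f x)"
proof -
  obtain c where c: "\<forall>x. f x = (\<Sum>k\<in>{k. (\<Sum>i\<in>UNIV. k i) \<le> t}. c k * (\<Prod>i\<in>UNIV. (x $ i) ^ k i))"
    using assms unfolding poly_fun_deg_le_def by blast
  let ?up = "\<lambda>k :: 'n \<Rightarrow> nat. k(i := Suc (k i))" and ?down = "\<lambda>k :: 'n \<Rightarrow> nat. k(i := k i - 1)"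
  have sum_up: "(\<Sum>j\<in>UNIV. ?up k j) = Suc (\<Sum>j\<in>UNIV. k j)" for k
    by (simp add: sum.remove[of UNIV i])
  have prod_up: "(\<Prod>j\<in>UNIV. (x $ j) ^ ?up k j) = x $ i * (\<Prod>j\<in>UNIV. (x $ j) ^ k j)" for k and x :: "real ^ 'n"
    by (simp add: prod.remove[of UNIV i] mult_ac)
  have "x $ i * f x = (\<Sum>k\<in>{k. (\<Sum>i\<in>UNIV. k i) \<le> Suc t}.
      (if k i > 0 then c (?down k) else 0) * (\<Prod>i\<in>UNIV. (x $ i) ^ k i))" for x
  proof -
    have "x $ i * f x = (\<Sum>k\<in>{k. (\<Sum>i\<in>UNIV. k i) \<le> t}. c k * (\<Prod>j\<in>UNIV. (x $ j) ^ ?up k j))"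
      unfolding prod_up using c by (simp add: sum_distrib_left mult_ac)
    also have "\<dots> = (\<Sum>k\<in>{k. (\<Sum>i\<in>UNIV. k i) \<le> Suc t \<and> k i > 0}. c (?down k) * (\<Prod>j\<in>UNIV. (x $ j) ^ k j))"
    proof (rule sum.reindex_bij_witness[where i = ?down and j = ?up])
      fix k :: "'n \<Rightarrow> nat" assume "k \<in> {k. (\<Sum>i\<in>UNIV. k i) \<le> Suc t \<and> k i > 0}"
      then have "?up (?down k) = k" "(\<Sum>i\<in>UNIV. k i) \<le> Suc t" by auto
      then show "?up (?down k) = k" "?down k \<in> {k. (\<Sum>i\<in>UNIV. k i) \<le> t}"
        using sum_up[of "?down k"] by auto
    qed (auto simp: sum_up simp del: fun_upd_apply, simp_all)
    also have "\<dots> = (\<Sum>k\<in>{k. (\<Sum>i\<in>UNIV. k i) \<le> Suc t}.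
        (if k i > 0 then c (?down k) else 0) * (\<Prod>i\<in>UNIV. (x $ i) ^ k i))"
      by (rule sum.mono_neutral_cong_left) (auto simp: finite_exponents)
    finally show ?thesis .
  qed
  then show ?thesis
    unfolding poly_fun_deg_le_def
    by (intro exI[of _ "\<lambda>k. if k i > 0 then c (?down k) else 0"]) blast
qed

lemma poly_fun_deg_le_inner_mult:
  fixes f :: "real ^ 'n::finite \<Rightarrow> real"
  assumes "poly_fun_deg_le t f"
  shows "poly_fun_deg_le (Suc t) (\<lambda>z. (x \<bullet> z) * f z)"
proof -
  have "(x \<bullet> z) * f z = (\<Sum>i\<in>UNIV. x $ i * (z $ i * f z))" for z
    by (simp add: inner_vec_def sum_distrib_left mult_ac)
  then show ?thesis
    using assms by (simp add: poly_fun_deg_le_sum poly_fun_deg_le_cmult poly_fun_deg_le_coordinate_mult)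
qed

lemma poly_fun_deg_le_inner_powers:
  "poly_fun_deg_le (a + b) (\<lambda>z :: real ^ 'n::finite. (x \<bullet> z) ^ a * (y \<bullet> z) ^ b)"
proof (induction a)
  case 0
  show ?case
    by (induction b) (simp_all add: poly_fun_deg_le_const poly_fun_deg_le_inner_mult)
next
  case (Suc a)
  then show ?case
    using poly_fun_deg_le_inner_mult by (simp add: mult.assoc)
qed

lemma poly_fun_deg_le_poly_inner:
  fixes x y :: "real ^ 'n::finite"
  assumes "degree p + degree q \<le> t"
  shows "poly_fun_deg_le t (\<lambda>z. poly p (x \<bullet> z) * poly q (y \<bullet> z))"
proof -
  have "poly p (x \<bullet> z) * poly q (y \<bullet> z) = (\<Sum>a\<le>degree p. \<Sum>b\<le>degree q.
      (coeff p a * coeff q b) * ((x \<bullet> z) ^ a * (y \<bullet> z) ^ b))" for z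
    by (simp add: poly_altdef sum_product mult_ac)
  moreover have "poly_fun_deg_le t (\<lambda>z. \<Sum>a\<le>degree p. \<Sum>b\<le>degree q.
      (coeff p a * coeff q b) * ((x \<bullet> z) ^ a * (y \<bullet> z) ^ b))"
    using assms by (intro poly_fun_deg_le_sum poly_fun_deg_le_cmult
        poly_fun_deg_le_mono[OF poly_fun_deg_le_inner_powers]) auto
  ultimately show ?thesis by simp
qed

lemma spherical_design_zonal_mean:
  fixes x y :: "real ^ 'n::finite"
  assumes "spherical_design t X" "degree p + degree q \<le> t"
  shows "(\<Sum>z\<in>X. poly p (x \<bullet> z) * poly q (y \<bullet> z)) / real (card X) = zonal_mean x y p q"
  using assms poly_fun_deg_le_poly_inner[OF assms(2)]
  unfolding spherical_design_def zonal_mean_def sphere_mean_def by blast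

section \<open>Primitive idempotents of a matrix algebra with an orthogonal basis\<close>

lemma lin_comb_add: "(\<lambda>x y. lin_comb s c M x y + lin_comb s d M x y) = lin_comb s (\<lambda>i. c i + d i) M"
  by (simp add: lin_comb_def sum.distrib algebra_simps)

lemma lin_comb_zero: "lin_comb s (\<lambda>_. 0) M = zero_mat"
  by (simp add: lin_comb_def zero_mat_def)

lemma lin_comb_unit: "i \<le> s \<Longrightarrow> lin_comb s (\<lambda>j. of_bool (j = i)) M = M i"
  by (simp add: lin_comb_def of_bool_def if_distrib[of "\<lambda>x. x * _"] cong: if_cong)

text \<open>
  In the coordinates given by E the product is computed entry by entry, so the idempotents are the 0/1 vectors,
  and such a vector is a sum of two nonzero orthogonal ones exactly if it has more than one entry 1.
\<close>

lemma primitive_idempotents_orthogonal_basis: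
  assumes alg: "\<A> = {lin_comb s c E | c. True}"
    and prod: "\<And>c d. mat_prod X (lin_comb s c E) (lin_comb s d E) = lin_comb s (\<lambda>i. c i * d i) E"
    and unique: "\<And>c d. lin_comb s c E = lin_comb s d E \<Longrightarrow> \<forall>i\<le>s. c i = d i"
  shows "bij_betw E {0..s} {e. primitive_idempotent X \<A> e}"
proof -
  have eq_iff: "lin_comb s c E = lin_comb s d E \<longleftrightarrow> (\<forall>i\<le>s. c i = d i)" for c d
    using unique[of c d] by (auto simp: lin_comb_def)
  have zero_iff: "lin_comb s c E = zero_mat \<longleftrightarrow> (\<forall>i\<le>s. c i = 0)" for c
    by (simp add: eq_iff flip: lin_comb_zero[of s E])
  have idem_iff: "idempotent X (lin_comb s c E) \<longleftrightarrow> (\<forall>i\<le>s. c i = 0 \<or> c i = 1)" for c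
    by (simp add: idempotent_def prod eq_iff)
  have unit: "E i = lin_comb s (\<lambda>j. of_bool (j = i)) E" if "i \<le> s" for i
    using that by (simp add: lin_comb_unit)
  have inj: "inj_on E {0..s}"
  proof (rule inj_onI)
    fix i j assume ij: "i \<in> {0..s}" "j \<in> {0..s}" "E i = E j"
    then have "lin_comb s (\<lambda>k. of_bool (k = i)) E = lin_comb s (\<lambda>k. of_bool (k = j)) E"
      by (simp add: lin_comb_unit)
    then show "i = j"
      using ij unfolding eq_iff by (auto split: if_splits dest: spec[of _ i])
  qed
  have prim: "primitive_idempotent X \<A> (E i)" if i: "i \<le> s" for i
    unfolding primitive_idempotent_def
  proof (intro conjI notI)
    show "E i \<in> \<A>"
      unfolding alg using unit[OF i] by blast
    show "E i = zero_mat \<Longrightarrow> False"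
      using i by (auto simp: unit[OF i] zero_iff)
    show "idempotent X (E i)"
      by (auto simp: unit[OF i] idem_iff)
    assume "\<exists>f\<in>\<A>. \<exists>g\<in>\<A>. f \<noteq> zero_mat \<and> g \<noteq> zero_mat \<and> idempotent X f \<and> idempotent X g \<and>
      mat_prod X f g = zero_mat \<and> mat_prod X g f = zero_mat \<and> E i = (\<lambda>x y. f x y + g x y)"
    then obtain c d where c: "lin_comb s c E \<noteq> zero_mat" "idempotent X (lin_comb s c E)"
      and d: "lin_comb s d E \<noteq> zero_mat" "idempotent X (lin_comb s d E)"
      and sum: "E i = (\<lambda>x y. lin_comb s c E x y + lin_comb s d E x y)"
      unfolding alg by blast
    have "lin_comb s (\<lambda>j. of_bool (j = i)) E = lin_comb s (\<lambda>i. c i + d i) E"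
      using sum by (simp only: lin_comb_add lin_comb_unit[OF i])
    then have cd: "of_bool (j = i) = c j + d j" if "j \<le> s" for j
      using that unfolding eq_iff by blast
    have cases: "c j = 0 \<or> c j = 1" "d j = 0 \<or> d j = 1" if "j \<le> s" for j
      using that c(2) d(2) unfolding idem_iff by blast+
    obtain j k where jk: "j \<le> s" "c j \<noteq> 0" "k \<le> s" "d k \<noteq> 0"
      using c(1) d(1) unfolding zero_iff by blast
    have "j = i" "d j = 0"
      using jk cd[of j] cases[of j] by (cases "j = i"; auto)+
    moreover have "k = i"
      using jk cd[of k] cases[of k] by (cases "k = i"; auto)
    ultimately show False
      using jk by simp
  qed
  have conv: "e \<in> E ` {0..s}" if e: "primitive_idempotent X \<A> e" for e
  proof -
    obtain c where c: "e = lin_comb s c E"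
      using e unfolding primitive_idempotent_def alg by blast
    have idem: "\<forall>i\<le>s. c i = 0 \<or> c i = 1" and "\<exists>i\<le>s. c i \<noteq> 0"
      using e unfolding primitive_idempotent_def c idem_iff zero_iff by auto
    then obtain i where i: "i \<le> s" "c i = 1" by auto
    have "c j = 0" if j: "j \<le> s" "j \<noteq> i" for j
    proof (rule ccontr)
      assume "c j \<noteq> 0"
      define f where "f = lin_comb s (\<lambda>k. of_bool (k = i)) E"
      define g where "g = lin_comb s (\<lambda>k. if k = i then 0 else c k) E"
      have "f \<in> \<A>" "g \<in> \<A>"
        unfolding alg f_def g_def by blast+
      moreover have "f \<noteq> zero_mat" "g \<noteq> zero_mat"
        using i j \<open>c j \<noteq> 0\<close> by (auto simp: f_def g_def zero_iff)
      moreover have "idempotent X f" "idempotent X g"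
        using idem by (auto simp: f_def g_def idem_iff)
      moreover have "mat_prod X f g = zero_mat" "mat_prod X g f = zero_mat"
        by (auto simp: f_def g_def prod zero_iff)
      moreover have "e = (\<lambda>x y. f x y + g x y)"
        unfolding c f_def g_def lin_comb_add eq_iff using i by auto
      ultimately show False
        using e unfolding primitive_idempotent_def by blast
    qed
    then have "e = E i"
      unfolding c unit[OF i(1)] eq_iff using i by auto
    then show ?thesis using i by auto
  qed
  show ?thesis
    unfolding bij_betw_def using inj prim conv by auto
qed

section \<open>Functions of the inner product on an antipodal design\<close>

text \<open>
  Throughout, N is the number of points and A the set of inner products, including 1.  A function F
  on A stands for the matrix with the entries $F(x \cdot y)$.
\<close>

locale antipodal_design =
  fixes X :: "(real ^ 'n::finite) set" and n s t :: nat
  assumes n_def: "n = CARD('n)"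
    and antipodal: "antipodal X"
    and design: "spherical_design t X"
    and dist: "distance_set s X"
    and t: "int t \<ge> 2 * int s - 3"
begin

definition N :: real where "N = real (card X)"

definition A :: "real set" where "A = insert 1 (inner_products X)"

lemma finite_X: "finite X" and X_nonempty: "X \<noteq> {}" and norm_X: "x \<in> X \<Longrightarrow> norm x = 1"
  using design by (auto simp: spherical_design_def)

lemma inner_self_X: "x \<in> X \<Longrightarrow> x \<bullet> x = 1"
  by (simp add: norm_X dot_square_norm)

lemma minus_X: "x \<in> X \<Longrightarrow> - x \<in> X"
  using antipodal by (simp add: antipodal_def)

lemma N_pos: "N > 0"
  using finite_X X_nonempty by (simp add: N_def card_gt_0_iff)

lemma inner_eq_1_iff: "x \<in> X \<Longrightarrow> y \<in> X \<Longrightarrow> x \<bullet> y = 1 \<longleftrightarrow> x = y"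
  using norm_X[of x] norm_X[of y] norm_cauchy_schwarz_eq[of x y] inner_self_X by auto

lemma inner_eq_minus_1_iff: "x \<in> X \<Longrightarrow> y \<in> X \<Longrightarrow> x \<bullet> y = - 1 \<longleftrightarrow> y = - x"
  using inner_eq_1_iff[of x "- y"] minus_X[of y] by auto

lemma minus_neq_X: "x \<in> X \<Longrightarrow> - x \<noteq> x"
  using norm_X[of x] by (metis neg_eq_iff_add_eq_0 norm_zero scaleR_2 scaleR_eq_0_iff zero_neq_numeral zero_neq_one)

lemma inner_in_A: "x \<in> X \<Longrightarrow> y \<in> X \<Longrightarrow> x \<bullet> y \<in> A"
  by (cases "x = y") (auto simp: A_def inner_products_def inner_self_X)

lemma A_attained: "a \<in> A \<Longrightarrow> \<exists>x\<in>X. \<exists>y\<in>X. x \<bullet> y = a"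
  using X_nonempty inner_self_X by (auto simp: A_def inner_products_def)

lemma one_in_A: "1 \<in> A"
  by (simp add: A_def)

lemma minus_in_A: "a \<in> A \<Longrightarrow> - a \<in> A"
  using A_attained[of a] inner_in_A minus_X by (metis inner_minus_right)

lemma one_notin_inner_products: "1 \<notin> inner_products X"
  by (auto simp: inner_products_def inner_eq_1_iff)

lemma finite_A: "finite A" and card_A: "card A = s + 1"
  using dist one_notin_inner_products by (auto simp: A_def distance_set_def)

lemma minus_one_in_A: "- 1 \<in> A"
  using minus_in_A one_in_A by blast

lemma s_pos: "s \<ge> 1"
proof -
  have "card {1, - 1 :: real} \<le> card A"
    using one_in_A minus_one_in_A finite_A by (intro card_mono) auto
  then show ?thesis by (simp add: card_A)
qed

text \<open>
  On the line, unit vectors have only the inner products 1 and -1.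
\<close>

lemma n_ge_2:
  assumes "s \<ge> 2"
  shows "n \<ge> 2"
proof (rule ccontr)
  assume "\<not> n \<ge> 2"
  then have "CARD('n) = 1"
    using n_def by (metis One_nat_def Suc_leI le_antisym not_less_eq_eq numeral_2_eq_2 zero_less_card_finite)
  then obtain i :: 'n where i: "(UNIV :: 'n set) = {i}"
    by (rule card_1_singletonE)
  have inner: "x \<bullet> y = x $ i * y $ i" for x y :: "real ^ 'n"
    by (simp add: inner_vec_def i)
  have "x \<bullet> y \<in> {1, -1}" if "x \<in> X" "y \<in> X" for x y
  proof -
    have "(x \<bullet> y) ^ 2 = (x \<bullet> x) * (y \<bullet> y)"
      unfolding inner by (simp add: power2_eq_square)
    then have "(x \<bullet> y) ^ 2 = 1"
      using that by (simp add: inner_self_X)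
    then show ?thesis by (simp add: power2_eq_1_iff)
  qed
  then have "A \<subseteq> {1, -1}"
    using A_attained by blast
  then have "card A \<le> card {1, -1 :: real}"
    by (intro card_mono) auto
  then show False
    using assms by (simp add: card_A)
qed

text \<open>
  The product of the matrices of F and G, divided by N.  At this point it need not depend on
  $x \cdot y$ only.
\<close>

definition conv :: "(real \<Rightarrow> real) \<Rightarrow> (real \<Rightarrow> real) \<Rightarrow> real ^ 'n \<Rightarrow> real ^ 'n \<Rightarrow> real" where
  "conv F G x y = (\<Sum>z\<in>X. F (x \<bullet> z) * G (z \<bullet> y)) / N"

text \<open>
  The trace form, for which the functions of distinct idempotents are orthogonal.
\<close>

definition ip :: "(real \<Rightarrow> real) \<Rightarrow> (real \<Rightarrow> real) \<Rightarrow> real" where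
  "ip F G = (\<Sum>x\<in>X. \<Sum>y\<in>X. F (x \<bullet> y) * G (x \<bullet> y)) / N\<^sup>2"

text \<open>
  The function of $N (I + (-1)^i D) / 2$, where D is the antipodal permutation matrix.
\<close>

definition antipodal_fun :: "nat \<Rightarrow> real \<Rightarrow> real" where
  "antipodal_fun i u = N / 2 * (of_bool (u = 1) + (- 1) ^ i * of_bool (u = - 1))"

definition low_fun :: "nat \<Rightarrow> real \<Rightarrow> real" where
  "low_fun i u = (\<Sum>k | k + 2 \<le> s \<and> even (i + k). poly (zonal n k) u)"

text \<open>
  The function of N times the i-th idempotent.  The last two idempotents are what the zonal
  polynomials of degree at most s - 2 leave of the projections to functions of a given parity.
\<close>

definition efun :: "nat \<Rightarrow> real \<Rightarrow> real" where
  "efun i u = (if i + 2 \<le> s then poly (zonal n i) u else antipodal_fun i u - low_fun i u)"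

lemma finite_low: "finite {k. k + 2 \<le> s \<and> P k}"
  by (rule finite_subset[of _ "{..s}"]) auto

lemma conv_cong: "(\<And>a. a \<in> A \<Longrightarrow> F a = F' a) \<Longrightarrow> (\<And>a. a \<in> A \<Longrightarrow> G a = G' a) \<Longrightarrow>
  x \<in> X \<Longrightarrow> y \<in> X \<Longrightarrow> conv F G x y = conv F' G' x y"
  by (simp add: conv_def inner_in_A)

lemma conv_commute: "conv F G x y = conv G F y x"
  by (simp add: conv_def inner_commute mult.commute)

lemma conv_cmult_left: "conv (\<lambda>u. c * F u) G x y = c * conv F G x y"
  by (simp add: conv_def sum_distrib_left algebra_simps)

lemma conv_diff_left: "conv (\<lambda>u. F u - F' u) G x y = conv F G x y - conv F' G x y"
  by (simp add: conv_def sum_subtractf algebra_simps diff_divide_distrib)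

lemma conv_sum_left: "conv (\<lambda>u. \<Sum>i\<in>I. F i u) G x y = (\<Sum>i\<in>I. conv (F i) G x y)"
  unfolding conv_def by (subst sum_divide_distrib[symmetric], subst sum.swap) (simp add: sum_distrib_right)

lemma conv_sum_right: "conv G (\<lambda>u. \<Sum>i\<in>I. F i u) x y = (\<Sum>i\<in>I. conv G (F i) x y)"
  using conv_sum_left[of F I G y x] by (simp add: conv_commute[of G])

lemma conv_cmult_right: "conv G (\<lambda>u. c * F u) x y = c * conv G F x y"
  using conv_cmult_left[of c F G y x] by (simp add: conv_commute[of G])

lemma conv_diff_right: "conv G (\<lambda>u. F u - F' u) x y = conv G F x y - conv G F' x y"
  using conv_diff_left[of F F' G y x] by (simp add: conv_commute[of G])

lemma ip_conv: "ip F G = (\<Sum>x\<in>X. conv F G x x) / N"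
  by (simp add: ip_def conv_def power2_eq_square sum_divide_distrib inner_commute)

lemma conv_antipodal_fun:
  assumes x: "x \<in> X" and y: "y \<in> X"
  shows "conv (antipodal_fun i) F x y = (F (x \<bullet> y) + (- 1) ^ i * F (- (x \<bullet> y))) / 2"
proof -
  have "(\<Sum>z\<in>X. antipodal_fun i (x \<bullet> z) * F (z \<bullet> y)) =
      (\<Sum>z\<in>X. (if z = x then N / 2 * F (x \<bullet> y) else 0) + (if z = - x then N / 2 * (- 1) ^ i * F (- (x \<bullet> y)) else 0))"
    using x minus_neq_X[OF x]
    by (intro sum.cong refl) (auto simp: antipodal_fun_def inner_eq_1_iff inner_eq_minus_1_iff)
  also have "\<dots> = N / 2 * F (x \<bullet> y) + N / 2 * (- 1) ^ i * F (- (x \<bullet> y))"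
    using x minus_X[OF x] by (simp add: sum.distrib finite_X)
  finally show ?thesis
    using N_pos by (simp add: conv_def field_simps)
qed

lemma conv_opposite_parity:
  assumes F: "\<And>a. a \<in> A \<Longrightarrow> F (- a) = (- 1) ^ i * F a" and G: "\<And>a. a \<in> A \<Longrightarrow> G (- a) = (- 1) ^ j * G a"
    and ij: "odd (i + j)" and x: "x \<in> X" and y: "y \<in> X"
  shows "conv F G x y = 0"
proof -
  have "(\<Sum>z\<in>X. F (x \<bullet> z) * G (z \<bullet> y)) = (\<Sum>z\<in>X. F (x \<bullet> (- z)) * G ((- z) \<bullet> y))"
    by (rule sum.reindex_bij_witness[where i = uminus and j = uminus]) (auto simp: minus_X)
  also have "\<dots> = (\<Sum>z\<in>X. - (F (x \<bullet> z) * G (z \<bullet> y)))"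
  proof (rule sum.cong)
    fix z assume z: "z \<in> X"
    have "(- 1) ^ i * (- 1) ^ j = (- 1 :: real)"
      using ij by (simp flip: power_add)
    moreover have "F (x \<bullet> (- z)) * G ((- z) \<bullet> y) = ((- 1) ^ i * (- 1) ^ j) * (F (x \<bullet> z) * G (z \<bullet> y))"
      using F[of "x \<bullet> z"] G[of "z \<bullet> y"] x y z by (simp add: inner_in_A)
    ultimately show "F (x \<bullet> (- z)) * G ((- z) \<bullet> y) = - (F (x \<bullet> z) * G (z \<bullet> y))" by simp
  qed simp
  finally show ?thesis
    by (simp add: conv_def sum_negf)
qed

text \<open>
  The strength of the design enters here: the product has degree at most 2s - 4.
\<close>

lemma conv_zonal:
  assumes k: "k + 2 \<le> s" and l: "l + 2 \<le> s" and x: "x \<in> X" and y: "y \<in> X"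
  shows "conv (poly (zonal n k)) (poly (zonal n l)) x y = (if k = l then poly (zonal n k) (x \<bullet> y) else 0)"
proof -
  have "degree (zonal n k) + degree (zonal n l) \<le> t"
    using degree_zonal[of n k] degree_zonal[of n l] k l t by linarith
  from spherical_design_zonal_mean[OF design this, of x y]
  have "conv (poly (zonal n k)) (poly (zonal n l)) x y = zonal_mean x y (zonal n k) (zonal n l)"
    by (simp add: conv_def N_def inner_commute)
  also have "\<dots> = (if k = l then poly (zonal n k) (x \<bullet> y) else 0)"
    unfolding n_def using k n_ge_2 x y by (intro zonal_mean_zonal norm_X) (auto simp: n_def)
  finally show ?thesis .
qed

lemma antipodal_fun_uminus: "antipodal_fun i (- a) = (- 1) ^ i * antipodal_fun i a"
  by (cases "even i") (auto simp: antipodal_fun_def minus_equation_iff)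

lemma low_fun_uminus: "low_fun i (- a) = (- 1) ^ i * low_fun i a"
  unfolding low_fun_def sum_distrib_left
  by (intro sum.cong refl) (auto simp: poly_zonal_uminus minus_one_power_iff)

lemma efun_uminus: "efun i (- a) = (- 1) ^ i * efun i a"
  by (simp add: efun_def poly_zonal_uminus antipodal_fun_uminus low_fun_uminus algebra_simps)

text \<open>
  For equal parities, the function antipodal_fun acts as an identity and
  low_fun as the projection to the zonal polynomials, so that the last two idempotents are
  complementary projections.
\<close>

lemma conv_efun:
  assumes i: "i \<le> s" and j: "j \<le> s" and x: "x \<in> X" and y: "y \<in> X"
  shows "conv (efun i) (efun j) x y = (if i = j then efun i (x \<bullet> y) else 0)"
proof (cases "odd (i + j)")
  case True
  then show ?thesis
    using conv_opposite_parity[of "efun i" i "efun j" j] x y efun_uminus by auto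
next
  case even: False
  have low_zonal: "conv (low_fun i) (poly (zonal n j)) x y = poly (zonal n j) (x \<bullet> y)"
    if "j + 2 \<le> s" "even (i + j)" "x \<in> X" "y \<in> X" for i j x y
  proof -
    have "conv (low_fun i) (poly (zonal n j)) x y =
        (\<Sum>k | k + 2 \<le> s \<and> even (i + k). if k = j then poly (zonal n k) (x \<bullet> y) else 0)"
      unfolding low_fun_def conv_sum_left using that by (intro sum.cong refl) (simp add: conv_zonal)
    also have "\<dots> = poly (zonal n j) (x \<bullet> y)"
      using that by (subst sum.delta[OF finite_low]) simp
    finally show ?thesis .
  qed
  have low_low: "conv (low_fun i) (low_fun i) x y = low_fun i (x \<bullet> y)" for i
  proof -
    have "conv (low_fun i) (low_fun i) x y =
        (\<Sum>k | k + 2 \<le> s \<and> even (i + k). conv (low_fun i) (poly (zonal n k)) x y)"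
      by (subst (2) low_fun_def[abs_def]) (rule conv_sum_right)
    also have "\<dots> = low_fun i (x \<bullet> y)"
      unfolding low_fun_def[of i "x \<bullet> y"] using x y by (intro sum.cong refl low_zonal) auto
    finally show ?thesis .
  qed
  have antipodal_even: "conv (antipodal_fun i) F x y = F (x \<bullet> y)"
    if "\<And>a. F (- a) = (- 1) ^ i * F a" "x \<in> X" "y \<in> X" for i F x y
    using that by (simp add: conv_antipodal_fun flip: power_add mult.assoc)
  have high_zonal: "conv (\<lambda>u. antipodal_fun i u - low_fun i u) (poly (zonal n j)) x y = 0"
    if "j + 2 \<le> s" "even (i + j)" "x \<in> X" "y \<in> X" for i j x y
  proof -
    have "(- 1) ^ j = ((- 1) ^ i :: real)"
      using that by (simp add: minus_one_power_iff)
    then show ?thesis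
      using that by (simp add: conv_diff_left low_zonal antipodal_even poly_zonal_uminus)
  qed
  have efun_low: "efun k = poly (zonal n k)" if "k + 2 \<le> s" for k
    using that by (simp add: efun_def[abs_def])
  have efun_high: "efun k = (\<lambda>u. antipodal_fun k u - low_fun k u)" if "\<not> k + 2 \<le> s" for k
    using that by (simp add: efun_def[abs_def])
  consider "i + 2 \<le> s" "j + 2 \<le> s" | "\<not> i + 2 \<le> s" "j + 2 \<le> s" | "i + 2 \<le> s" "\<not> j + 2 \<le> s"
    | "\<not> i + 2 \<le> s" "\<not> j + 2 \<le> s" by blast
  then show ?thesis
  proof cases
    case 1
    then show ?thesis
      using x y by (simp add: efun_low conv_zonal)
  next
    case 2
    then show ?thesis
      using x y even high_zonal by (auto simp: efun_low efun_high)
  next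
    case 3
    then show ?thesis
      using x y even high_zonal[of i j y x] by (auto simp: efun_low efun_high conv_commute[of "poly _"] add.commute)
  next
    case 4
    then have "i = j"
      using even i j by presburger
    have "conv (low_fun i) (antipodal_fun i) x y = low_fun i (x \<bullet> y)"
      using antipodal_even[of "low_fun i" i y x] x y low_fun_uminus
      by (simp add: conv_commute[of "low_fun i"] inner_commute)
    then show ?thesis
      using \<open>i = j\<close> 4 x y
      by (simp add: efun_high conv_diff_left conv_diff_right low_low antipodal_even
          low_fun_uminus antipodal_fun_uminus)
  qed
qed

lemma ip_efun:
  assumes "i \<le> s" "j \<le> s"
  shows "ip (efun i) (efun j) = (if i = j then efun i 1 else 0)"
  using assms N_pos by (simp add: ip_conv conv_efun inner_self_X N_def)

lemma ip_cong: "(\<And>a. a \<in> A \<Longrightarrow> F a = F' a) \<Longrightarrow> (\<And>a. a \<in> A \<Longrightarrow> G a = G' a) \<Longrightarrow> ip F G = ip F' G'"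
  by (simp add: ip_def inner_in_A)

lemma ip_commute: "ip F G = ip G F"
  by (simp add: ip_def mult.commute)

lemma ip_add_left: "ip (\<lambda>u. F u + F' u) G = ip F G + ip F' G"
  by (simp add: ip_def sum.distrib algebra_simps add_divide_distrib)

lemma ip_cmult_left: "ip (\<lambda>u. c * F u) G = c * ip F G"
  by (simp add: ip_def sum_distrib_left algebra_simps)

lemma ip_diff_left: "ip (\<lambda>u. F u - F' u) G = ip F G - ip F' G"
  by (simp add: ip_def sum_subtractf algebra_simps diff_divide_distrib)

lemma ip_sum_left: "ip (\<lambda>u. \<Sum>i\<in>I. F i u) G = (\<Sum>i\<in>I. ip (F i) G)"
  by (simp add: ip_conv conv_sum_left sum_divide_distrib[symmetric] sum.swap[of _ I])

lemma ip_self_eq_0: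
  assumes "ip F F = 0" "a \<in> A"
  shows "F a = 0"
proof -
  obtain x y where xy: "x \<in> X" "y \<in> X" "x \<bullet> y = a"
    using A_attained[OF assms(2)] by blast
  have "(\<Sum>x\<in>X. \<Sum>y\<in>X. F (x \<bullet> y) * F (x \<bullet> y)) = 0"
    using assms(1) N_pos by (simp add: ip_def)
  then have "(\<Sum>y\<in>X. F (x \<bullet> y) * F (x \<bullet> y)) = 0"
    using xy finite_X by (subst (asm) sum_nonneg_eq_0_iff) (auto intro: sum_nonneg)
  then have "F (x \<bullet> y) * F (x \<bullet> y) = 0"
    using xy finite_X by (subst (asm) sum_nonneg_eq_0_iff) auto
  then show ?thesis using xy by simp
qed

lemma ip_self_nonneg: "ip F F \<ge> 0"
  by (auto simp: ip_def intro!: sum_nonneg divide_nonneg_nonneg)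

section \<open>Completeness and Krein numbers\<close>

definition interior_A :: "real set" where "interior_A = A - {1, -1}"

lemma card_interior_A: "card interior_A = s - 1"
  using one_in_A minus_one_in_A finite_A by (simp add: interior_A_def card_Diff_subset card_A)

lemma finite_interior_A: "finite interior_A"
  using finite_A by (simp add: interior_A_def)

definition low_poly :: "nat \<Rightarrow> real poly" where
  "low_poly i = (\<Sum>k | k + 2 \<le> s \<and> even (i + k). zonal n k)"

lemma poly_low_poly: "poly (low_poly i) u = low_fun i u"
  by (simp add: low_poly_def low_fun_def poly_sum)

lemma degree_low_poly: "degree (low_poly i) \<le> s - 2"
  unfolding low_poly_def using finite_low
  by (intro degree_sum_le) (auto intro: order_trans[OF degree_zonal])

text \<open>
  Otherwise the polynomial low_fun would vanish at the s - 1 inner products other than 1 and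
  -1, hence identically, although its value at 1 would be N / 2.
\<close>

lemma efun_nonzero:
  assumes i: "i \<le> s" "\<not> i + 2 \<le> s"
  shows "\<exists>a\<in>A. efun i a \<noteq> 0"
proof (rule ccontr)
  assume "\<not> ?thesis"
  then have zero: "low_fun i a = antipodal_fun i a" if "a \<in> A" for a
    using that i by (auto simp: efun_def)
  have one: "antipodal_fun i 1 = N / 2"
    by (simp add: antipodal_fun_def)
  have "low_poly i = 0"
  proof (rule ccontr)
    assume nz: "low_poly i \<noteq> 0"
    then have "s \<ge> 2"
      using finite_low by (auto simp: low_poly_def intro: ccontr)
    have "poly (low_poly i) a = 0" if "a \<in> interior_A" for a
      using zero[of a] that by (simp add: poly_low_poly interior_A_def antipodal_fun_def)
    then have "interior_A \<subseteq> {a. poly (low_poly i) a = 0}"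
      by blast
    then have "s - 1 \<le> degree (low_poly i)"
      using card_mono[OF poly_roots_finite[OF nz]] card_poly_roots_bound[OF nz] card_interior_A
      by (metis order_trans)
    then show False
      using degree_low_poly[of i] \<open>s \<ge> 2\<close> by simp
  qed
  then have "low_fun i 1 = 0"
    by (metis poly_low_poly poly_0)
  then show False
    using zero[OF one_in_A] one N_pos by simp
qed

text \<open>
  The rank of the i-th idempotent, as its trace.
\<close>

definition mult :: "nat \<Rightarrow> real" where "mult i = efun i 1"

lemma mult_pos:
  assumes i: "i \<le> s"
  shows "mult i > 0"
proof (cases "i + 2 \<le> s")
  case True
  then show ?thesis
    using zonal_one_pos[OF n_ge_2] by (simp add: mult_def efun_def)
next
  case False
  obtain a where "a \<in> A" "efun i a \<noteq> 0"
    using efun_nonzero[OF i False] by blast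
  then have "ip (efun i) (efun i) \<noteq> 0"
    using ip_self_eq_0 by blast
  then show ?thesis
    using ip_self_nonneg[of "efun i"] ip_efun[OF i i] by (simp add: mult_def)
qed

lemma ip_antipodal_fun: "ip F (antipodal_fun i) = (F 1 + (- 1) ^ i * F (- 1)) / 2"
proof -
  have "ip F (antipodal_fun i) = ip (antipodal_fun i) F"
    by (rule ip_commute)
  also have "\<dots> = (F 1 + (- 1) ^ i * F (- 1)) / 2"
    using N_pos by (simp add: ip_conv conv_antipodal_fun inner_self_X N_def)
  finally show ?thesis .
qed

lemma ip_add_right: "ip G (\<lambda>u. F u + F' u) = ip G F + ip G F'"
  by (simp add: ip_commute[of G] ip_add_left)

lemma ip_cmult_right: "ip G (\<lambda>u. c * F u) = c * ip G F"
  by (simp add: ip_commute[of G] ip_cmult_left)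

lemma ip_sum_right: "ip G (\<lambda>u. \<Sum>i\<in>I. F i u) = (\<Sum>i\<in>I. ip G (F i))"
  by (simp add: ip_commute[of G] ip_sum_left)

text \<open>
  Completeness.  Orthogonality to the zonal polynomials means orthogonality to all polynomials of
  degree at most s - 2, and then the last two idempotents force F to vanish at 1 and -1.  At any other
  inner product a, test F against the polynomial whose roots are the remaining s - 2 inner products.
\<close>

lemma orthogonal_efun_eq_0:
  assumes orth: "\<And>i. i \<le> s \<Longrightarrow> ip F (efun i) = 0" and a: "a \<in> A"
  shows "F a = 0"
proof -
  have zonal0: "ip F (poly (zonal n k)) = 0" if "k + 2 \<le> s" for k
    using orth[of k] that by (simp add: efun_def[abs_def])
  have antipodal0: "ip F (antipodal_fun i) = 0" if "i \<le> s" "\<not> i + 2 \<le> s" for i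
  proof -
    have "antipodal_fun i = (\<lambda>u. efun i u + low_fun i u)"
      using that by (simp add: efun_def fun_eq_iff)
    then have "ip F (antipodal_fun i) = ip F (efun i) + ip F (low_fun i)"
      by (simp add: ip_add_right)
    also have "ip F (low_fun i) = 0"
      unfolding low_fun_def[abs_def] ip_sum_right by (intro sum.neutral) (auto intro: zonal0)
    finally show ?thesis
      using orth that by simp
  qed
  have ends: "F 1 = 0" "F (- 1) = 0"
  proof -
    have "F 1 + (- 1) ^ s * F (- 1) = 0" "F 1 + (- 1) ^ (s - 1) * F (- 1) = 0"
      using antipodal0[of s] antipodal0[of "s - 1"] s_pos by (simp_all add: ip_antipodal_fun)
    moreover have "(- 1) ^ s * F (- 1) = - ((- 1) ^ (s - 1) * F (- 1))"
      using s_pos by (cases s) simp_all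
    ultimately have "F 1 = 0" "(- 1) ^ (s - 1) * F (- 1) = 0" by linarith+
    then show "F 1 = 0" "F (- 1) = 0" by simp_all
  qed
  \<comment> \<open>Each factor u raises the degree of the zonal polynomial by at most one.\<close>
  have monom_zonal: "ip F (\<lambda>u. u ^ d * poly (zonal n k) u) = 0" if "k + d + 2 \<le> s" for d k
    using that
  proof (induction d arbitrary: k)
    case (Suc d)
    have "u ^ Suc d * poly (zonal n k) u = up_coeff n k * (u ^ d * poly (zonal n (k + 1)) u) +
        down_coeff n k * (u ^ d * poly (zonal n (k - 1)) u)" for u
      using arg_cong[OF zonal_mult[of n k], of "\<lambda>p. u ^ d * poly p u"] n_ge_2 Suc.prems
      by (simp add: algebra_simps)
    then show ?case
      using Suc.IH[of "k + 1"] Suc.IH[of "k - 1"] Suc.prems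
      by (simp add: ip_add_right ip_cmult_right)
  qed (simp add: zonal0)
  show ?thesis
  proof (cases "a \<in> interior_A")
    case False
    then show ?thesis
      using a ends by (auto simp: interior_A_def)
  next
    case True
    then have "card (interior_A - {a}) = s - 2"
      by (simp add: card_interior_A finite_interior_A)
    have "card interior_A > 0"
      using True finite_interior_A card_gt_0_iff by blast
    then have s2: "s \<ge> 2" by (simp add: card_interior_A)
    define p where "p = (\<Prod>b\<in>interior_A - {a}. [:- b, 1:])"
    have deg: "degree p = s - 2"
      unfolding p_def using \<open>card (interior_A - {a}) = s - 2\<close> by (subst degree_prod_eq_sum_degree) auto
    have roots: "poly p b = 0 \<longleftrightarrow> b \<in> interior_A - {a}" for b
      unfolding p_def poly_prod using finite_interior_A by (auto simp: prod_zero_iff)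
    have "ip F (poly p) = (\<Sum>d\<le>degree p. coeff p d * ip F (\<lambda>u. u ^ d * poly (zonal n 0) u))"
      unfolding poly_altdef[abs_def] by (simp add: ip_sum_right ip_cmult_right)
    also have "\<dots> = 0"
      using monom_zonal[of 0] deg s2 by (intro sum.neutral ballI) (auto simp del: zonal_0)
    finally have "0 = ip F (poly p)" ..
    also have "\<dots> = (\<Sum>x\<in>X. \<Sum>y\<in>X. (F a * poly p a) * of_bool (x \<bullet> y = a)) / N\<^sup>2"
      unfolding ip_def using ends roots inner_in_A
      by (intro arg_cong2[where f = "(/)"] sum.cong refl) (auto simp: interior_A_def)
    also have "\<dots> = F a * poly p a * ((\<Sum>x\<in>X. \<Sum>y\<in>X. of_bool (x \<bullet> y = a)) / N\<^sup>2)"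
      by (simp add: sum_distrib_left)
    finally have "F a * poly p a * ((\<Sum>x\<in>X. \<Sum>y\<in>X. of_bool (x \<bullet> y = a)) / N\<^sup>2) = 0" by simp
    moreover have "(\<Sum>x\<in>X. \<Sum>y\<in>X. of_bool (x \<bullet> y = a)) > (0 :: real)"
    proof -
      obtain x y where xy: "x \<in> X" "y \<in> X" "x \<bullet> y = a"
        using A_attained[OF a] by blast
      have "(\<Sum>y\<in>X. of_bool (x \<bullet> y = a)) > (0 :: real)"
        using xy(3) by (intro sum_pos2[OF finite_X xy(2)]) auto
      then show ?thesis
        by (rule sum_pos2[OF finite_X xy(1)]) (auto intro: sum_nonneg)
    qed
    ultimately show ?thesis
      using roots N_pos by simp
  qed
qed

text \<open>
  Coordinates with respect to the idempotent functions.
\<close>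

definition fourier :: "(real \<Rightarrow> real) \<Rightarrow> nat \<Rightarrow> real" where
  "fourier F i = ip F (efun i) / mult i"

lemma fourier_expansion:
  assumes a: "a \<in> A"
  shows "F a = (\<Sum>i\<le>s. fourier F i * efun i a)"
proof -
  define H where "H = (\<lambda>u. F u - (\<Sum>i\<le>s. fourier F i * efun i u))"
  have "ip H (efun j) = 0" if j: "j \<le> s" for j
  proof -
    have "ip H (efun j) = ip F (efun j) - (\<Sum>i\<le>s. fourier F i * ip (efun i) (efun j))"
      by (simp add: H_def ip_diff_left ip_sum_left ip_cmult_left)
    also have "(\<Sum>i\<le>s. fourier F i * ip (efun i) (efun j)) = (\<Sum>i\<le>s. if i = j then fourier F i * mult i else 0)"
      using j by (intro sum.cong refl) (auto simp: ip_efun mult_def)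
    also have "\<dots> = ip F (efun j)"
      using j mult_pos[OF j] by (simp add: fourier_def)
    finally show ?thesis by simp
  qed
  then have "H a = 0"
    using orthogonal_efun_eq_0[OF _ a] by blast
  then show ?thesis by (simp add: H_def)
qed

lemma fourier_unique:
  assumes F: "\<And>a. a \<in> A \<Longrightarrow> F a = (\<Sum>i\<le>s. c i * efun i a)" and j: "j \<le> s"
  shows "fourier F j = c j"
proof -
  have "ip F (efun j) = ip (\<lambda>u. \<Sum>i\<le>s. c i * efun i u) (efun j)"
    using F by (intro ip_cong) auto
  also have "\<dots> = (\<Sum>i\<le>s. if i = j then c i * mult i else 0)"
    unfolding ip_sum_left ip_cmult_left using j by (intro sum.cong refl) (auto simp: ip_efun mult_def)
  also have "\<dots> = c j * mult j"
    using j by simp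
  finally show ?thesis
    using mult_pos[OF j] by (simp add: fourier_def)
qed

text \<open>
  The right-hand side depends on x and y through their inner product only: the matrices of functions
  on A form an algebra.
\<close>

lemma conv_fourier:
  assumes x: "x \<in> X" and y: "y \<in> X"
  shows "conv F G x y = (\<Sum>i\<le>s. fourier F i * fourier G i * efun i (x \<bullet> y))"
proof -
  have "conv F G x y = conv (\<lambda>u. \<Sum>i\<le>s. fourier F i * efun i u) (\<lambda>u. \<Sum>j\<le>s. fourier G j * efun j u) x y"
    using x y by (intro conv_cong fourier_expansion)
  also have "\<dots> = (\<Sum>i\<le>s. \<Sum>j\<le>s. if i = j then fourier F i * fourier G j * efun i (x \<bullet> y) else 0)"
    unfolding conv_sum_left conv_sum_right conv_cmult_left conv_cmult_right using x y
    by (intro sum.cong refl) (auto simp: conv_efun)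
  finally show ?thesis by simp
qed

definition krein :: "nat \<Rightarrow> nat \<Rightarrow> nat \<Rightarrow> real" where
  "krein i j k = fourier (\<lambda>u. efun i u * efun j u) k"

text \<open>
  Up to a multiplicity this is the Krein number, and it is symmetric in all three indices.
\<close>

definition triple :: "nat \<Rightarrow> nat \<Rightarrow> nat \<Rightarrow> real" where
  "triple i j k = ip (\<lambda>u. efun i u * efun j u) (efun k)"

lemma krein_triple: "krein i j k = triple i j k / mult k"
  by (simp add: krein_def triple_def fourier_def)

lemma triple_rotate: "triple i j k = triple i k j"
  by (simp add: triple_def ip_def mult_ac)

lemma krein_expansion: "a \<in> A \<Longrightarrow> efun i a * efun j a = (\<Sum>k\<le>s. krein i j k * efun k a)"
  unfolding krein_def by (rule fourier_expansion)

lemma krein_sum: "(\<Sum>k\<le>s. krein i j k * mult k) = mult i * mult j"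
  using krein_expansion[OF one_in_A, of i j] by (simp add: mult_def)

lemma triple_sum: "(\<Sum>k\<le>s. triple i j k) = mult i * mult j"
proof -
  have "(\<Sum>k\<le>s. triple i j k) = (\<Sum>k\<le>s. krein i j k * mult k)"
    using mult_pos by (intro sum.cong refl) (simp add: krein_triple less_imp_neq[symmetric])
  then show ?thesis by (simp add: krein_sum)
qed

text \<open>
  The product of the three functions is odd on A, and the design is antipodal.
\<close>

lemma triple_odd:
  assumes "odd (i + j + k)"
  shows "triple i j k = 0"
proof -
  have "conv (\<lambda>u. efun i u * efun j u) (efun k) x x = 0" if "x \<in> X" for x
    using assms that efun_uminus
    by (intro conv_opposite_parity[where i = "i + j" and j = k]) (auto simp: power_add)
  then show ?thesis
    by (simp add: triple_def ip_conv)
qed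

lemma krein_odd: "odd (i + j + k) \<Longrightarrow> krein i j k = 0"
  by (simp add: krein_triple triple_odd)

section \<open>Multiplicities and multiplication by the first idempotent\<close>

lemma n_pos: "n \<ge> 1"
  by (simp add: n_def Suc_le_eq)

lemma low_fun_gegenbauer:
  assumes "i = s \<or> i = s - 1"
  shows "low_fun i u = poly (gegenbauer n (i - 1)) u"
proof -
  obtain m where m: "s = Suc m"
    using s_pos by (cases s) auto
  have "k + 2 \<le> s \<and> even (i + k) \<longleftrightarrow> k < i - 1 \<and> odd (i - 1 + k)" for k
  proof (cases "i = s")
    case True
    then show ?thesis using m by auto
  next
    case False
    then have "i = m" using assms m by simp
    then show ?thesis using m by (cases m; auto simp: less_Suc_eq le_less)
  qed
  then show ?thesis
    unfolding low_fun_def gegenbauer_sum poly_sum by (simp only:)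
qed

lemma mult_low: "i + 2 \<le> s \<Longrightarrow> mult i = poly (zonal n i) 1"
  by (simp add: mult_def efun_def)

lemma mult_high: "i = s \<or> i = s - 1 \<Longrightarrow> mult i = N / 2 - poly (gegenbauer n (i - 1)) 1"
proof -
  assume i: "i = s \<or> i = s - 1"
  then have "\<not> i + 2 \<le> s" using s_pos by auto
  then show ?thesis
    unfolding mult_def efun_def low_fun_gegenbauer[OF i] by (simp add: antipodal_fun_def)
qed

lemma mult_low_ibinom:
  assumes "i + 2 \<le> s"
  shows "mult i = ibinom (int n + int i - 1) (int i) - ibinom (int n + int i - 3) (int i - 2)"
proof (cases i)
  case 0
  then show ?thesis
    using assms by (simp add: mult_low ibinom_def)
next
  case (Suc k)
  have "mult i = poly (gegenbauer n (k + 2)) 1 - poly (gegenbauer n k) 1"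
    using assms Suc by (simp add: mult_low zonal_def)
  also have "\<dots> = ibinom (int n + int (k + 2) - 2) (int (k + 2) - 1) - ibinom (int n + int k - 2) (int k - 1)"
    by (simp only: gegenbauer_one_ibinom[OF n_pos])
  moreover have "int n + int (k + 2) - 2 = int n + int i - 1" "int (k + 2) - 1 = int i"
    "int n + int k - 2 = int n + int i - 3" "int k - 1 = int i - 2"
    using Suc by simp_all
  ultimately show ?thesis by (simp only:)
qed

lemma mult_high_ibinom:
  "mult (s - 1) = N / 2 - ibinom (int n + int s - 4) (int s - 3)"
  "mult s = N / 2 - ibinom (int n + int s - 3) (int s - 2)"
proof -
  have s1: "int (s - 1) = int s - 1"
    using s_pos by simp
  have "int n + (int s - 1) - 2 = int n + int s - 3" "int s - 1 - 1 = int s - 2" by simp_all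
  then show "mult s = N / 2 - ibinom (int n + int s - 3) (int s - 2)"
    using mult_high[of s, OF disjI1[OF refl]] by (simp only: gegenbauer_one_ibinom[OF n_pos] s1)
  show "mult (s - 1) = N / 2 - ibinom (int n + int s - 4) (int s - 3)"
  proof (cases "s = 1")
    case True
    then show ?thesis
      using mult_high[of "s - 1"] by (simp add: ibinom_def)
  next
    case False
    then have s2: "int (s - 1 - 1) = int s - 2"
      using s_pos by simp
    have "int n + (int s - 2) - 2 = int n + int s - 4" "int s - 2 - 1 = int s - 3" by simp_all
    then show ?thesis
      using mult_high[of "s - 1", OF disjI2[OF refl]] by (simp only: gegenbauer_one_ibinom[OF n_pos] s2)
  qed
qed

text \<open>
  For s = 1 the design consists of two opposite points.  The general formulas hold there, but the
  constant function is not one of the zonal polynomials of degree at most s - 2.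
\<close>

lemma A_small: "s = 1 \<Longrightarrow> A = {1, -1}"
  using card_subset_eq[OF finite_A, of "{1, -1}"] one_in_A minus_one_in_A card_A by auto

lemma N_small:
  assumes "s = 1"
  shows "N = 2"
proof -
  obtain x where x: "x \<in> X" using X_nonempty by blast
  have "antipodal_fun 0 (x \<bullet> z) = N / 2" if "z \<in> X" for z
    using inner_in_A[OF x that] A_small[OF assms] by (auto simp: antipodal_fun_def)
  then have "(\<Sum>z\<in>X. antipodal_fun 0 (x \<bullet> z)) = (\<Sum>z\<in>X. N / 2)"
    by (intro sum.cong refl)
  then have "conv (antipodal_fun 0) (\<lambda>_. 1) x x = N / 2"
    using N_pos by (simp add: conv_def N_def)
  then show ?thesis
    using conv_antipodal_fun[OF x x, of 0 "\<lambda>_. 1"] by simp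
qed

lemma efun_0: "a \<in> A \<Longrightarrow> efun 0 a = 1"
proof (cases "s \<ge> 2")
  case False
  assume a: "a \<in> A"
  have s: "s = 1" using False s_pos by simp
  have "{k. k + 2 \<le> s \<and> even (0 + k)} = {}" using s by simp
  then show ?thesis
    using a s A_small[OF s] N_small[OF s] unfolding efun_def low_fun_def
    by (auto simp: antipodal_fun_def)
qed (simp add: efun_def)

lemma mult_0: "mult 0 = 1"
  by (simp add: mult_def efun_0 one_in_A)

text \<open>
  For s at least 3 this is the first zonal polynomial.  For smaller s the set A is contained in
  {1, 0, -1}, where every odd function is a multiple of the identity.
\<close>

lemma efun_1:
  assumes a: "a \<in> A"
  shows "efun 1 a = mult 1 * a"
proof (cases "s \<ge> 3")
  case False
  have "{k. k + 2 \<le> s \<and> even (1 + k)} = {}"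
    using False by auto presburger
  then have "low_fun 1 u = 0" for u
    unfolding low_fun_def by (simp only: sum.empty)
  then have eq: "efun 1 = antipodal_fun 1"
    using False by (simp add: fun_eq_iff efun_def)
  show ?thesis
  proof (cases "a \<in> interior_A")
    case True
    then have "card {a, - a} \<le> s - 1"
      using minus_in_A[of a] finite_interior_A unfolding card_interior_A[symmetric]
      by (intro card_mono) (auto simp: interior_A_def minus_equation_iff)
    then have "a = - a"
      using False by (cases "a = - a") auto
    then show ?thesis
      unfolding eq by (simp add: antipodal_fun_def)
  next
    case False
    then show ?thesis
      using a efun_uminus[of 1 1] by (auto simp: mult_def interior_A_def)
  qed
qed (simp add: efun_def mult_def zonal_1)

text \<open>
  In the case s < 3 the second moment of the design at x is 1 / n, and idempotency of the first
  idempotent turns it into the rank.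
\<close>

lemma mult_1:
  assumes "s \<ge> 3 \<or> spherical_design 2 X"
  shows "mult 1 = real n"
proof (cases "s \<ge> 3")
  case False
  then have des: "spherical_design 2 X" using assms by simp
  obtain x where x: "x \<in> X" using X_nonempty by blast
  have "(\<Sum>z\<in>X. (x \<bullet> z) * (x \<bullet> z)) / N = zonal_mean x x [:0, 1:] [:0, 1:]"
    using spherical_design_zonal_mean[OF des, of "[:0, 1:]" "[:0, 1:]" x x] by (simp add: N_def)
  moreover have "real n * zonal_mean x x [:0, 1:] [:0, 1:] = 1"
    using sphere_mean_two_powers[OF norm_X[OF x], of 0 1 x] x
    by (simp add: zonal_mean_def n_def inner_self_X sphere_mean_one)
  moreover have "mult 1 = mult 1 * mult 1 * ((\<Sum>z\<in>X. (x \<bullet> z) * (x \<bullet> z)) / N)"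
  proof -
    have "mult 1 = conv (efun 1) (efun 1) x x"
      using conv_efun[of 1 1 x x] s_pos x by (simp add: mult_def inner_self_X)
    also have "\<dots> = conv (\<lambda>u. mult 1 * u) (\<lambda>u. mult 1 * u) x x"
      using x by (intro conv_cong efun_1)
    finally show ?thesis
      by (simp add: conv_def sum_distrib_left inner_commute mult_ac)
  qed
  ultimately have "mult 1 * zonal_mean x x [:0, 1:] [:0, 1:] = real n * zonal_mean x x [:0, 1:] [:0, 1:]"
    using mult_pos[of 1] s_pos by simp
  then show ?thesis
    using \<open>real n * zonal_mean x x [:0, 1:] [:0, 1:] = 1\<close>
    by (subst (asm) mult_right_cancel) auto
qed (simp add: mult_def efun_def zonal_1)

lemma triple_1_low:
  assumes i: "i + 3 \<le> s" and j: "j \<le> s"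
  shows "triple 1 i j = (if j = Suc i then real n * up_coeff n i * mult j else 0) +
    (if i = Suc j then real n * down_coeff n i * mult j else 0)"
proof -
  have "efun 1 a * efun i a = real n * up_coeff n i * efun (Suc i) a + real n * down_coeff n i * efun (i - 1) a"
    for a
  proof -
    have "i - 1 + 2 \<le> s" using i by simp
    then show ?thesis
      using i arg_cong[OF zonal_mult[OF n_pos, of i], of "\<lambda>p. real n * poly p a"]
      by (simp add: efun_def zonal_1 algebra_simps)
  qed
  then have "triple 1 i j = real n * up_coeff n i * ip (efun (Suc i)) (efun j) +
      real n * down_coeff n i * ip (efun (i - 1)) (efun j)"
    by (simp add: triple_def ip_add_left ip_cmult_left)
  then show ?thesis
    using i j by (cases i) (auto simp: ip_efun mult_def down_coeff_def)
qed

text \<open>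
  By symmetry the three-term recurrence covers all pairs with an index up to s - 3.  Of the remaining
  pairs, those with i = j and the pair s - 2, s have the wrong parity.
\<close>

lemma triple_1_far:
  assumes i: "i \<le> s" and j: "j \<le> s" and ij: "j \<noteq> Suc i" "i \<noteq> Suc j"
  shows "triple 1 i j = 0"
proof (cases "i + 3 \<le> s \<or> j + 3 \<le> s")
  case True
  then show ?thesis
    using triple_1_low[of i j] triple_1_low[of j i] triple_rotate[of 1 i j] i j ij by auto
next
  case False
  then have "odd (1 + i + j)"
    using i j ij by presburger
  then show ?thesis by (rule triple_odd)
qed

text \<open>
  The value at 1 of the expansion of the product of the functions number 1 and i.
\<close>

lemma triple_1_row:
  assumes i: "i \<le> s"
  shows "(if i = 0 then 0 else triple 1 i (i - 1)) + (if i = s then 0 else triple 1 i (Suc i)) = mult 1 * mult i"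
proof -
  have "mult 1 * mult i = (\<Sum>k\<le>s. (if k = i - 1 then if i = 0 then 0 else triple 1 i (i - 1) else 0) +
      (if k = Suc i then triple 1 i (Suc i) else 0))"
    unfolding triple_sum[symmetric] using i by (intro sum.cong refl) (auto simp: triple_1_far simp del: One_nat_def)
  also have "\<dots> = (if i = 0 then 0 else triple 1 i (i - 1)) + (if i = s then 0 else triple 1 i (Suc i))"
    using i by (auto simp: sum.distrib)
  finally show ?thesis ..
qed

lemma triple_1_step:
  assumes i: "i + 2 \<le> s"
  shows "triple 1 i (Suc i) = mult 1 * down_coeff n (Suc i) * mult i"
proof (cases "i + 3 \<le> s")
  case True
  then have "mult 1 = real n"
    by (intro mult_1) simp
  then show ?thesis
    using True triple_1_low[of i "Suc i"] zonal_one_step[OF n_pos, of i] by (simp add: mult_low)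
next
  case False
  show ?thesis
  proof (cases i)
    case 0
    then show ?thesis
      using triple_1_row[of 0] i by (simp add: down_coeff_def)
  next
    case (Suc k)
    have n: "mult 1 = real n"
      using i Suc by (intro mult_1) simp
    have "triple 1 i k = real n * up_coeff n k * mult i"
      using Suc i triple_1_low[of k i] triple_rotate[of 1 i k] by simp
    then have "triple 1 i (Suc i) = real n * (1 - up_coeff n k) * mult i"
      using triple_1_row[of i] i Suc n by (simp add: algebra_simps)
    then show ?thesis
      using one_minus_up_coeff[OF n_pos, of k] Suc n by simp
  qed
qed

lemma triple_1_last: "triple 1 (s - 1) s = mult 1 * mult s"
  using triple_1_row[of s] s_pos triple_rotate[of 1 s "s - 1"] by simp

lemma triple_1_110: "triple 1 1 0 = mult 1"
proof -
  have "triple 1 1 0 = ip (efun 1) (efun 1)"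
    unfolding triple_def ip_def using efun_0 inner_in_A by simp
  then show ?thesis
    using ip_efun[of 1 1] s_pos by (simp add: mult_def)
qed

lemma triple_1_pos:
  assumes "Suc i \<le> s"
  shows "triple 1 i (Suc i) > 0"
proof (cases "i + 2 \<le> s")
  case True
  then show ?thesis
    using triple_1_step[OF True] mult_pos[of 1] mult_pos[of i] down_coeff_pos[OF n_ge_2, of i] by simp
next
  case False
  then have "s = Suc i" using assms by simp
  then show ?thesis
    using triple_1_last mult_pos[of 1] mult_pos[of s] by simp
qed

lemma Q_polynomial_krein: "Q_polynomial s krein"
  unfolding Q_polynomial_def
proof (intro allI impI conjI)
  fix i j assume i: "i \<le> s" and j: "j \<le> s"
  show "krein 1 i j = 0" if "\<bar>int i - int j\<bar> > 1"
    using that triple_1_far[OF i j] by (auto simp: krein_triple)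
  show "krein 1 i j \<noteq> 0" if "\<bar>int i - int j\<bar> = 1"
  proof -
    have "j = Suc i \<or> i = Suc j" using that by auto
    then have "triple 1 i j > 0"
      using triple_1_pos[of i] triple_1_pos[of j] triple_rotate[of 1 i j] i j by auto
    then show ?thesis
      using mult_pos[OF j] by (simp add: krein_triple)
  qed
qed

section \<open>The association scheme and its eigenmatrices\<close>

definition kernel_mat :: "(real \<Rightarrow> real) \<Rightarrow> (real ^ 'n) rmat" where
  "kernel_mat F = (\<lambda>x y. if x \<in> X \<and> y \<in> X then F (x \<bullet> y) else 0)"

definition idem_mat :: "nat \<Rightarrow> (real ^ 'n) rmat" where
  "idem_mat i = kernel_mat (\<lambda>u. efun i u / N)"

lemma kernel_mat_cong: "(\<And>a. a \<in> A \<Longrightarrow> F a = G a) \<Longrightarrow> kernel_mat F = kernel_mat G"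
  by (auto simp: kernel_mat_def fun_eq_iff inner_in_A)

lemma kernel_mat_eqD:
  assumes "kernel_mat F = kernel_mat G" "a \<in> A"
  shows "F a = G a"
proof -
  obtain x y where xy: "x \<in> X" "y \<in> X" "x \<bullet> y = a"
    using A_attained[OF assms(2)] by blast
  then show ?thesis
    using fun_cong[OF fun_cong[OF assms(1)], of x y] by (simp add: kernel_mat_def)
qed

lemma lin_comb_kernel_mat: "lin_comb s c (\<lambda>i. kernel_mat (F i)) = kernel_mat (\<lambda>u. \<Sum>i\<le>s. c i * F i u)"
  by (auto simp: lin_comb_def kernel_mat_def fun_eq_iff)

text \<open>
  The expansion of F in matrix form; for the indicator of one inner product it is a row of the first
  eigenmatrix.
\<close>

lemma kernel_mat_idem_mat: "kernel_mat F = lin_comb s (\<lambda>i. N * fourier F i) idem_mat"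
  unfolding idem_mat_def lin_comb_kernel_mat using N_pos
  by (intro kernel_mat_cong) (simp add: fourier_expansion[symmetric])

lemma lin_comb_idem_mat_unique:
  assumes "lin_comb s c idem_mat = lin_comb s d idem_mat"
  shows "\<forall>i\<le>s. c i = d i"
proof (intro allI impI)
  fix i assume i: "i \<le> s"
  have fourier: "fourier (\<lambda>u. \<Sum>i\<le>s. c i * (efun i u / N)) i = c i / N" for c
    using i by (intro fourier_unique) auto
  have "(\<Sum>i\<le>s. c i * (efun i a / N)) = (\<Sum>i\<le>s. d i * (efun i a / N))" if "a \<in> A" for a
    using kernel_mat_eqD[OF _ that] assms unfolding idem_mat_def lin_comb_kernel_mat by blast
  then have "fourier (\<lambda>u. \<Sum>i\<le>s. c i * (efun i u / N)) i = fourier (\<lambda>u. \<Sum>i\<le>s. d i * (efun i u / N)) i"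
    unfolding fourier_def by (intro arg_cong2[where f = "(/)"] ip_cong) auto
  then show "c i = d i"
    using N_pos unfolding fourier by simp
qed

lemma mat_prod_kernel_mat:
  "mat_prod X (kernel_mat F) (kernel_mat G) = kernel_mat (\<lambda>u. N * (\<Sum>i\<le>s. fourier F i * fourier G i * efun i u))"
proof (intro ext)
  fix x y
  show "mat_prod X (kernel_mat F) (kernel_mat G) x y =
    kernel_mat (\<lambda>u. N * (\<Sum>i\<le>s. fourier F i * fourier G i * efun i u)) x y"
  proof (cases "x \<in> X \<and> y \<in> X")
    case True
    then have "mat_prod X (kernel_mat F) (kernel_mat G) x y = N * conv F G x y"
      using N_pos by (simp add: mat_prod_def kernel_mat_def conv_def)
    then show ?thesis
      using True conv_fourier[of x y F G] by (simp add: kernel_mat_def)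
  qed (auto simp: mat_prod_def kernel_mat_def)
qed

lemma mat_prod_idem_mat:
  "mat_prod X (lin_comb s c idem_mat) (lin_comb s d idem_mat) = lin_comb s (\<lambda>i. c i * d i) idem_mat"
proof -
  have "fourier (\<lambda>u. \<Sum>i\<le>s. c i * (efun i u / N)) i = c i / N" if "i \<le> s" for c i
    using that by (intro fourier_unique) auto
  then show ?thesis
    unfolding idem_mat_def lin_comb_kernel_mat mat_prod_kernel_mat using N_pos
    by (intro kernel_mat_cong) (simp add: sum_distrib_left)
qed

context
  fixes \<alpha> :: "nat \<Rightarrow> real"
  assumes ordering: "inner_product_ordering X s \<alpha>"
begin

lemma bij_ordering: "bij_betw \<alpha> {..s} A"
proof -
  have "bij_betw \<alpha> (insert 0 {1..s}) (insert 1 (inner_products X))"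
    using ordering one_notin_inner_products
    by (auto simp: inner_product_ordering_def bij_betw_def)
  moreover have "insert 0 {1..s} = {..s}" by auto
  ultimately show ?thesis by (simp add: A_def)
qed

lemma ordering_in_A: "i \<le> s \<Longrightarrow> \<alpha> i \<in> A"
  using bij_ordering by (auto simp: bij_betw_def)

lemma ordering_eq_iff: "i \<le> s \<Longrightarrow> j \<le> s \<Longrightarrow> \<alpha> i = \<alpha> j \<longleftrightarrow> i = j"
  using bij_ordering by (auto simp: bij_betw_def inj_on_def)

lemma ordering_cases: "a \<in> A \<Longrightarrow> \<exists>i\<le>s. a = \<alpha> i"
  using bij_ordering by (auto simp: bij_betw_def)

lemma adj_mat_kernel_mat: "adj_mat (inner_rel X \<alpha> i) = kernel_mat (\<lambda>u. of_bool (u = \<alpha> i))"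
  by (auto simp: adj_mat_def inner_rel_def kernel_mat_def fun_eq_iff)

lemma kernel_mat_adj_mat: "kernel_mat F = lin_comb s (\<lambda>i. F (\<alpha> i)) (\<lambda>i. adj_mat (inner_rel X \<alpha> i))"
  unfolding adj_mat_kernel_mat lin_comb_kernel_mat
proof (rule kernel_mat_cong)
  fix a assume "a \<in> A"
  then obtain j where j: "j \<le> s" "a = \<alpha> j"
    using ordering_cases by blast
  then have "(\<Sum>i\<le>s. F (\<alpha> i) * of_bool (a = \<alpha> i)) = (\<Sum>i\<le>s. if i = j then F (\<alpha> i) else 0)"
    by (intro sum.cong refl) (auto simp: ordering_eq_iff)
  then show "F a = (\<Sum>i\<le>s. F (\<alpha> i) * of_bool (a = \<alpha> i))"
    using j by simp
qed

lemma bose_mesner_kernel_mat: "bose_mesner s (\<lambda>i. adj_mat (inner_rel X \<alpha> i)) = {kernel_mat F | F. True}"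
  unfolding bose_mesner_def
proof (intro equalityI subsetI; clarify)
  fix c
  show "\<exists>F. lin_comb s c (\<lambda>i. adj_mat (inner_rel X \<alpha> i)) = kernel_mat F \<and> True"
    unfolding adj_mat_kernel_mat lin_comb_kernel_mat by blast
next
  fix F
  show "\<exists>c. kernel_mat F = lin_comb s c (\<lambda>i. adj_mat (inner_rel X \<alpha> i)) \<and> True"
    using kernel_mat_adj_mat by blast
qed

text \<open>
  The number of points z in a given relation to x and to y is an entry of a product of two adjacency
  matrices, so by conv_fourier it depends on $x \cdot y$ only.
\<close>

lemma association_scheme_inner_rel: "association_scheme X s (inner_rel X \<alpha>)"
proof -
  have "card {z \<in> X. (x, z) \<in> inner_rel X \<alpha> i \<and> (z, y) \<in> inner_rel X \<alpha> j} =
      nat \<lfloor>N * (\<Sum>l\<le>s. fourier (\<lambda>u. of_bool (u = \<alpha> i)) l * fourier (\<lambda>u. of_bool (u = \<alpha> j)) l * efun l (\<alpha> k))\<rfloor>"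
    if "(x, y) \<in> inner_rel X \<alpha> k" for i j k x y
  proof -
    have xy: "x \<in> X" "y \<in> X" "x \<bullet> y = \<alpha> k"
      using that by (auto simp: inner_rel_def)
    have "{z \<in> X. (x, z) \<in> inner_rel X \<alpha> i \<and> (z, y) \<in> inner_rel X \<alpha> j} =
        {z \<in> X. x \<bullet> z = \<alpha> i \<and> z \<bullet> y = \<alpha> j}"
      using xy by (auto simp: inner_rel_def)
    also have "real (card \<dots>) = (\<Sum>z\<in>X. of_bool (x \<bullet> z = \<alpha> i) * of_bool (z \<bullet> y = \<alpha> j))"
      using finite_X by (simp add: Int_def flip: of_bool_conj)
    also have "\<dots> = N * conv (\<lambda>u. of_bool (u = \<alpha> i)) (\<lambda>u. of_bool (u = \<alpha> j)) x y"
      using N_pos by (simp add: conv_def)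
    also have "\<dots> = N * (\<Sum>l\<le>s. fourier (\<lambda>u. of_bool (u = \<alpha> i)) l * fourier (\<lambda>u. of_bool (u = \<alpha> j)) l * efun l (\<alpha> k))"
      using conv_fourier[OF xy(1,2)] xy(3) by simp
    finally show ?thesis by linarith
  qed
  then have "\<exists>p. \<forall>(x, y)\<in>inner_rel X \<alpha> k.
      card {z \<in> X. (x, z) \<in> inner_rel X \<alpha> i \<and> (z, y) \<in> inner_rel X \<alpha> j} = p" for i j k
    by blast
  moreover have "(\<Union>i\<le>s. inner_rel X \<alpha> i) = X \<times> X"
    using ordering_cases inner_in_A by (fastforce simp: inner_rel_def)
  moreover have "inner_rel X \<alpha> i \<inter> inner_rel X \<alpha> j = {}" if "i \<le> s" "j \<le> s" "i \<noteq> j" for i j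
    using that ordering_eq_iff by (fastforce simp: inner_rel_def)
  moreover have "inner_rel X \<alpha> i \<noteq> {}" if "i \<le> s" for i
    using A_attained[OF ordering_in_A[OF that]] by (auto simp: inner_rel_def)
  moreover have "sym (inner_rel X \<alpha> i)" for i
    by (auto simp: inner_rel_def sym_def inner_commute)
  moreover have "inner_rel X \<alpha> 0 = Id_on X"
    using ordering by (auto simp: inner_rel_def inner_product_ordering_def inner_eq_1_iff inner_self_X)
  ultimately show ?thesis
    unfolding association_scheme_def using finite_X by simp
qed

lemma idempotent_ordering_idem_mat:
  "idempotent_ordering X s (\<lambda>i. adj_mat (inner_rel X \<alpha> i)) idem_mat"
  unfolding idempotent_ordering_def
proof
  show "bij_betw idem_mat {0..s}
      {e. primitive_idempotent X (bose_mesner s (\<lambda>i. adj_mat (inner_rel X \<alpha> i))) e}"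
  proof (rule primitive_idempotents_orthogonal_basis)
    have "{kernel_mat F | F. True} = {lin_comb s c idem_mat | c. True}"
    proof (intro equalityI subsetI; clarify)
      fix F
      show "\<exists>c. kernel_mat F = lin_comb s c idem_mat \<and> True"
        using kernel_mat_idem_mat by blast
    next
      fix c
      show "\<exists>F. lin_comb s c idem_mat = kernel_mat F \<and> True"
        unfolding idem_mat_def lin_comb_kernel_mat by blast
    qed
    then show "bose_mesner s (\<lambda>i. adj_mat (inner_rel X \<alpha> i)) = {lin_comb s c idem_mat | c. True}"
      by (simp only: bose_mesner_kernel_mat)
  qed (rule mat_prod_idem_mat lin_comb_idem_mat_unique, assumption?)+
  show "idem_mat 0 = (\<lambda>x y. all_ones X x y / real (card X))"
    by (auto simp: idem_mat_def kernel_mat_def all_ones_def fun_eq_iff efun_0 inner_in_A N_def)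
qed

lemma second_eigenmatrix_efun:
  "second_eigenmatrix X s (\<lambda>i. adj_mat (inner_rel X \<alpha> i)) idem_mat (\<lambda>j i. efun j (\<alpha> i))"
  unfolding second_eigenmatrix_def
proof (intro allI impI)
  fix j
  have "(\<lambda>x y. real (card X) * idem_mat j x y) = kernel_mat (efun j)"
    using N_pos by (auto simp: idem_mat_def kernel_mat_def fun_eq_iff N_def)
  then show "(\<lambda>x y. real (card X) * idem_mat j x y) =
      lin_comb s (\<lambda>i. efun j (\<alpha> i)) (\<lambda>i. adj_mat (inner_rel X \<alpha> i))"
    by (simp add: kernel_mat_adj_mat)
qed

lemma first_eigenmatrix_fourier:
  "first_eigenmatrix s (\<lambda>i. adj_mat (inner_rel X \<alpha> i)) idem_mat (\<lambda>j i. N * fourier (\<lambda>u. of_bool (u = \<alpha> j)) i)"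
  unfolding first_eigenmatrix_def adj_mat_kernel_mat using kernel_mat_idem_mat by blast

end

lemma krein_numbers_krein: "krein_numbers X s idem_mat krein"
  unfolding krein_numbers_def
proof (intro allI impI ext)
  fix i j x y
  have N: "real (card X) * idem_mat i x y = kernel_mat (efun i) x y" for i x y
    using N_pos by (auto simp: idem_mat_def kernel_mat_def N_def)
  show "real (card X) * idem_mat i x y * (real (card X) * idem_mat j x y) =
      lin_comb s (krein i j) (\<lambda>k x y. real (card X) * idem_mat k x y) x y"
    unfolding N lin_comb_def
    by (cases "x \<in> X \<and> y \<in> X") (auto simp: kernel_mat_def krein_expansion inner_in_A)
qed

text \<open>
  The adjacency matrix of the antipodal relation is the difference of the projections to the even and to
  the odd functions, hence has the eigenvalue $(-1)^i$ on the i-th idempotent.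
\<close>

lemma fourier_minus_one:
  assumes i: "i \<le> s"
  shows "N * fourier (\<lambda>u. of_bool (u = - 1)) i = (- 1) ^ i"
proof -
  have "(\<Sum>y\<in>X. of_bool (x \<bullet> y = - 1) * efun i (x \<bullet> y)) = efun i (- 1)" if "x \<in> X" for x
  proof -
    have "(\<Sum>y\<in>X. of_bool (x \<bullet> y = - 1) * efun i (x \<bullet> y)) = (\<Sum>y\<in>X. if y = - x then efun i (- 1) else 0)"
      using that by (intro sum.cong refl) (auto simp: inner_eq_minus_1_iff inner_self_X)
    then show ?thesis
      using that minus_X finite_X by simp
  qed
  then have "ip (\<lambda>u. of_bool (u = - 1)) (efun i) = efun i (- 1) / N"
    using N_pos by (simp add: ip_def N_def power2_eq_square)
  then show ?thesis
    using N_pos mult_pos[OF i] efun_uminus[of i 1] by (simp add: fourier_def mult_def)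
qed

text \<open>
  List the positive inner products, beginning with 1, each followed by its negative; if 0 is an inner
  product it comes last.  Since A is closed under negation, this happens exactly if s is even.
\<close>

lemma antipodal_ordering_exists:
  "\<exists>\<alpha>. inner_product_ordering X s \<alpha> \<and> (\<forall>i. 2 * i + 1 \<le> s \<longrightarrow> \<alpha> (2 * i + 1) = - \<alpha> (2 * i)) \<and>
    (even s \<longrightarrow> \<alpha> s = 0)"
proof -
  define P where "P = {a \<in> A. a > 0}"
  define g where "g = card (P - {1})"
  have fin: "finite P" and one: "1 \<in> P"
    using finite_A one_in_A by (auto simp: P_def)
  obtain b where b: "bij_betw b {1..g} (P - {1})"
    using ex_bij_betw_nat_finite_1[of "P - {1}"] fin by (auto simp: g_def)
  define b' where "b' = b(0 := 1)"
  have b'_P: "b' i \<in> P" if "i \<le> g" for i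
    using b that one by (auto simp: b'_def bij_betw_def)
  have P_b': "\<exists>i\<le>g. a = b' i" if "a \<in> P" for a
  proof (cases "a = 1")
    case False
    then have "a \<in> b ` {1..g}" using b that by (simp add: bij_betw_def)
    then obtain i where "1 \<le> i" "i \<le> g" "a = b i" by auto
    then show ?thesis by (intro exI[of _ i]) (simp add: b'_def)
  qed (auto simp: b'_def)
  have card_P: "card P = g + 1"
    using card.remove[OF fin one] by (simp add: g_def)
  have split: "A = P \<union> uminus ` P \<union> (A \<inter> {0})"
  proof (intro equalityI subsetI)
    fix a assume a: "a \<in> A"
    show "a \<in> P \<union> uminus ` P \<union> (A \<inter> {0})"
    proof (cases "a < 0")
      case True
      then have "- a \<in> P" using minus_in_A[OF a] by (simp add: P_def)
      then show ?thesis by (metis UnI1 UnI2 imageI minus_minus)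
    qed (use a in \<open>auto simp: P_def\<close>)
  qed (use minus_in_A in \<open>auto simp: P_def\<close>)
  have "card A = card (P \<union> uminus ` P) + card (A \<inter> {0})"
    by (subst split, subst card_Un_disjoint) (auto simp: P_def fin[unfolded P_def])
  also have "card (P \<union> uminus ` P) = card P + card (uminus ` P)"
    by (rule card_Un_disjoint) (auto simp: P_def fin[unfolded P_def])
  also have "card (uminus ` P) = card P"
    by (simp add: card_image)
  finally have s: "s + 1 = 2 * g + 2 + card (A \<inter> {0})"
    by (simp add: card_A card_P)
  have zero: "card (A \<inter> {0}) = (if 0 \<in> A then 1 else 0)" by simp
  \<comment> \<open>There are g + 1 positive inner products, so the indices up to 2g + 1 are taken by the pairs.\<close>
  define \<alpha> where "\<alpha> k = (if k = 2 * g + 2 then 0 else if even k then b' (k div 2) else - b' (k div 2))" for k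
  have "\<alpha> ` {..s} = A"
  proof
    show "\<alpha> ` {..s} \<subseteq> A"
    proof
      fix a assume "a \<in> \<alpha> ` {..s}"
      then obtain k where k: "k \<le> s" "a = \<alpha> k" by auto
      show "a \<in> A"
      proof (cases "k = 2 * g + 2")
        case True
        then show ?thesis
          using k s zero by (auto simp: \<alpha>_def split: if_splits)
      next
        case False
        then have "k div 2 \<le> g"
          using k s zero by (auto split: if_splits)
        then have "b' (k div 2) \<in> A"
          using b'_P by (auto simp: P_def)
        then show ?thesis
          using False minus_in_A k by (auto simp: \<alpha>_def)
      qed
    qed
    show "A \<subseteq> \<alpha> ` {..s}"
    proof
      fix a assume a: "a \<in> A"
      consider "a > 0" | "a < 0" | "a = 0" by linarith
      then show "a \<in> \<alpha> ` {..s}"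
      proof cases
        case 1
        then obtain i where "i \<le> g" "a = b' i"
          using P_b'[of a] a by (auto simp: P_def)
        then show ?thesis
          using s by (intro image_eqI[of _ _ "2 * i"]) (auto simp: \<alpha>_def)
      next
        case 2
        then obtain i where i: "i \<le> g" "- a = b' i"
          using P_b'[of "- a"] minus_in_A[OF a] by (auto simp: P_def)
        then have "a = - b' i" by simp
        then show ?thesis
          using s i by (intro image_eqI[of _ _ "2 * i + 1"]) (auto simp: \<alpha>_def)
      next
        case 3
        then show ?thesis
          using s zero a by (intro image_eqI[of _ _ "2 * g + 2"]) (auto simp: \<alpha>_def)
      qed
    qed
  qed
  \<comment> \<open>A surjection between sets of the same size s + 1.\<close>
  moreover have "inj_on \<alpha> {..s}"
    using calculation by (intro eq_card_imp_inj_on) (auto simp: card_A)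
  ultimately have bij: "bij_betw \<alpha> {..s} A"
    by (simp add: bij_betw_def)
  have \<alpha>0: "\<alpha> 0 = 1"
    by (simp add: \<alpha>_def b'_def)
  have "bij_betw \<alpha> ({..s} - {0}) (A - {1})"
    using bij_betw_DiffI[OF bij, of "{0}" "{1}"] \<alpha>0 one_in_A by simp
  moreover have "{..s} - {0} = {1..s}" "A - {1} = inner_products X"
    using one_notin_inner_products by (auto simp: A_def)
  ultimately have "inner_product_ordering X s \<alpha>"
    using \<alpha>0 by (simp add: inner_product_ordering_def)
  moreover have "\<alpha> (2 * i + 1) = - \<alpha> (2 * i)" if "2 * i + 1 \<le> s" for i
  proof -
    have "i \<le> g"
      using that s zero by (auto split: if_splits)
    moreover have "2 * i + 1 \<noteq> 2 * g + 2" by presburger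
    ultimately show ?thesis
      unfolding \<alpha>_def by (subst if_not_P) auto
  qed
  moreover have "\<alpha> s = 0" if "even s"
    using that s zero by (auto simp: \<alpha>_def split: if_splits)
  ultimately show ?thesis by blast
qed

section \<open>Entries of the dual intersection matrix\<close>

lemma krein_1_pred:
  assumes "i \<ge> 1" "i + 2 \<le> s"
  shows "krein 1 (i - 1) i = real n * real i / (real n + 2 * real i - 2)"
proof -
  obtain k where k: "i = Suc k" using assms by (cases i) auto
  then have "triple 1 k (Suc k) = real n * up_coeff n k * mult (Suc k)"
    using assms by (subst triple_1_low) auto
  then have "krein 1 k (Suc k) = real n * up_coeff n k"
    using mult_pos[of "Suc k"] assms k by (simp add: krein_triple)
  then show ?thesis
    using k by (simp add: up_coeff_def algebra_simps)
qed

lemma krein_1_succ: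
  assumes "i + 2 \<le> s"
  shows "krein 1 (Suc i) i = mult 1 * down_coeff n (Suc i)"
proof -
  have "triple 1 (Suc i) i = mult 1 * down_coeff n (Suc i) * mult i"
    using triple_1_step[OF assms] triple_rotate[of 1 i "Suc i"] by (simp only:)
  moreover have "mult i \<noteq> 0"
    using mult_pos[of i] assms by simp
  ultimately show ?thesis
    unfolding krein_triple by simp
qed

lemma krein_1_succ_low:
  assumes "1 \<le> i" "i + 3 \<le> s"
  shows "krein 1 (i + 1) i = real n * (real n + real i - 2) / (real n + 2 * real i - 2)"
  using assms krein_1_succ[of i] mult_1 by (simp add: down_coeff_def algebra_simps)

lemma krein_1_succ_high:
  assumes n: "mult 1 = real n" and s: "s \<ge> 2" "n + 2 * s \<noteq> 6"
  shows "krein 1 (s - 1) (s - 2) = real n * (real n + real s - 4) / (real n + 2 * real s - 6)"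
proof -
  obtain k where k: "s = k + 2"
    using s(1) le_Suc_ex by (metis add.commute)
  have "down_coeff n (Suc k) = (real n + real s - 4) / (real n + 2 * real s - 6)"
    using s(2) k by (cases k) (auto simp: down_coeff_def algebra_simps)
  then show ?thesis
    using krein_1_succ[of k] n k by simp
qed

lemma krein_1_last: "krein 1 (s - 1) s = mult 1"
  using triple_1_last mult_pos[of s] by (simp add: krein_triple)

lemma krein_1_10: "krein 1 1 0 = mult 1"
  by (simp add: krein_triple triple_1_110[simplified] mult_0)

text \<open>
  The denominator of the stated Krein numbers is a positive multiple of the multiplicity number s - 1.
\<close>

lemma mult_pred_scaled:
  assumes s: "s \<ge> 2"
  shows "2 * fact (s - 2) * fact (n - 1) * mult (s - 1) =
    fact (s - 2) * fact (n - 1) * real (card X) - 2 * (real s - 2) * fact (n + s - 4)"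
proof -
  have "poly (gegenbauer n (s - 2)) 1 * fact (s - 2) * fact (n - 1) = real (s - 2) * fact (n + (s - 2) - 2)"
    by (rule gegenbauer_one_closed[OF n_pos])
  moreover have "n + (s - 2) - 2 = n + s - 4" "real (s - 2) = real s - 2" "s - 1 - 1 = s - 2"
    using s by simp_all
  ultimately have G: "poly (gegenbauer n (s - 2)) 1 * fact (s - 2) * fact (n - 1) = (real s - 2) * fact (n + s - 4)"
    and M: "mult (s - 1) = N / 2 - poly (gegenbauer n (s - 2)) 1"
    using mult_high[of "s - 1", OF disjI2[OF refl]] by (simp_all only:)
  have "2 * fact (s - 2) * fact (n - 1) * mult (s - 1) = fact (s - 2) * fact (n - 1) * N -
      2 * (poly (gegenbauer n (s - 2)) 1 * fact (s - 2) * fact (n - 1))"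
    unfolding M by (simp add: algebra_simps)
  then show ?thesis
    unfolding G N_def by simp
qed

lemma mult_last_scaled:
  assumes s: "s \<ge> 2"
  shows "2 * fact (s - 2) * fact (n - 1) * mult s =
    fact (s - 2) * fact (n - 1) * real (card X) - 2 * fact (n + s - 3)"
proof -
  obtain k where k: "s = k + 2"
    using s le_Suc_ex by (metis add.commute)
  have "poly (gegenbauer n (Suc k)) 1 * fact (Suc k) * fact (n - 1) = real (Suc k) * fact (n + Suc k - 2)"
    by (rule gegenbauer_one_closed[OF n_pos])
  then have "real (Suc k) * (poly (gegenbauer n (Suc k)) 1 * fact k * fact (n - 1)) = real (Suc k) * fact (n + Suc k - 2)"
    by (simp add: algebra_simps)
  then have G: "poly (gegenbauer n (Suc k)) 1 * fact k * fact (n - 1) = fact (n + Suc k - 2)"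
    by (subst (asm) mult_left_cancel) simp_all
  have ks: "n + s - 3 = n + Suc k - 2" "s - 2 = k" "s - 1 = Suc k"
    using k by simp_all
  have M: "mult s = N / 2 - poly (gegenbauer n (Suc k)) 1"
    using mult_high[of s, OF disjI1[OF refl]] by (simp only: ks)
  have "2 * fact k * fact (n - 1) * mult s = fact k * fact (n - 1) * N -
      2 * (poly (gegenbauer n (Suc k)) 1 * fact k * fact (n - 1))"
    unfolding M by (simp add: algebra_simps)
  then show ?thesis
    unfolding G N_def ks by simp
qed

lemma krein_1_pred_high:
  assumes n: "mult 1 = real n" and s: "s \<ge> 2"
  shows "krein 1 (s - 2) (s - 1) = 2 * real n * (real n - 1) * fact (n + s - 4) /
    (fact (s - 2) * fact (n - 1) * real (card X) - 2 * (real s - 2) * fact (n + s - 4))"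
proof -
  have s2: "s - 2 + 2 \<le> s" "Suc (s - 2) = s - 1" using s by simp_all
  have "triple 1 (s - 2) (s - 1) = real n * down_coeff n (s - 1) * mult (s - 2)"
    using triple_1_step[OF s2(1)] n s2(2) by simp
  moreover have "mult (s - 2) * down_coeff n (s - 1) * fact (s - 2) * fact (n - 2) = fact (n + s - 4)"
    using zonal_one_closed[OF n_ge_2[OF s], of "s - 2"] s2 mult_low[OF s2(1)] s by simp
  moreover have "fact (n - 1) = (real n - 1) * fact (n - 2)"
    using n_ge_2[OF s] fact_reduce[of "n - 1", where 'a = real] by (simp add: numeral_2_eq_2)
  ultimately have "2 * fact (s - 2) * fact (n - 1) * triple 1 (s - 2) (s - 1) =
      2 * real n * (real n - 1) * fact (n + s - 4)"
    by (simp add: mult_ac)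
  then have "krein 1 (s - 2) (s - 1) = 2 * real n * (real n - 1) * fact (n + s - 4) /
      (2 * fact (s - 2) * fact (n - 1) * mult (s - 1))"
    using mult_pos[of "s - 1"] by (simp add: krein_triple field_simps)
  then show ?thesis
    by (simp only: mult_pred_scaled[OF s])
qed

lemma krein_1_last_pred:
  assumes n: "mult 1 = real n" and s: "s \<ge> 2"
  shows "krein 1 s (s - 1) =
    (fact (s - 2) * fact n * real (card X) - 2 * real n * fact (n + s - 3)) /
    (fact (s - 2) * fact (n - 1) * real (card X) - 2 * (real s - 2) * fact (n + s - 4))"
proof -
  have "krein 1 s (s - 1) = real n * mult s / mult (s - 1)"
    using triple_1_last triple_rotate[of 1 s "s - 1"] n by (simp add: krein_triple)
  also have "\<dots> = (real n * (2 * fact (s - 2) * fact (n - 1) * mult s)) /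
      (2 * fact (s - 2) * fact (n - 1) * mult (s - 1))"
    by simp
  also have "real n * (2 * fact (s - 2) * fact (n - 1) * mult s) =
      fact (s - 2) * fact n * real (card X) - 2 * real n * fact (n + s - 3)"
    unfolding mult_last_scaled[OF s] using fact_reduce[of n, where 'a = real] n_pos
    by (simp add: algebra_simps)
  finally show ?thesis
    by (simp only: mult_pred_scaled[OF s])
qed

end

section \<open>Antipodal designs of large strength\<close>

theorem theorem1p2:
  fixes X :: "(real ^ 'n::finite) set" and n s t :: nat
  assumes n: "n = CARD('n)"
    and antipodal: "antipodal X"
    and design: "spherical_design t X"
    and dist: "distance_set s X"
    and t: "int t \<ge> 2 * int s - 3"
  shows "(\<forall>\<alpha>. inner_product_ordering X s \<alpha> \<longrightarrow> association_scheme X s (inner_rel X \<alpha>)) \<and>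
    (\<exists>\<alpha> D E P Q q.
      inner_product_ordering X s \<alpha> \<and>
      D = (\<lambda>i. adj_mat (inner_rel X \<alpha> i)) \<and>
      idempotent_ordering X s D E \<and>
      first_eigenmatrix s D E P \<and>
      second_eigenmatrix X s D E Q \<and>
      krein_numbers X s E q \<and>
      \<comment> \<open>(1)\<close>
      (\<forall>i\<le>s. P 1 i = (-1) ^ i) \<and>
      \<comment> \<open>(2)\<close>
      (\<forall>i j. 2 * i + 1 \<le> s \<and> j \<le> s \<longrightarrow> Q j (2 * i + 1) = (-1) ^ j * Q j (2 * i)) \<and>
      (even s \<longrightarrow> (\<forall>j. odd j \<and> j < s \<longrightarrow> Q j s = 0)) \<and>
      \<comment> \<open>(3)\<close>
      (\<forall>i. i + 2 \<le> s \<longrightarrow>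
         Q i 0 = ibinom (int n + int i - 1) (int i) - ibinom (int n + int i - 3) (int i - 2)) \<and>
      Q (s - 1) 0 = real (card X) / 2 - ibinom (int n + int s - 4) (int s - 3) \<and>
      Q s 0 = real (card X) / 2 - ibinom (int n + int s - 3) (int s - 2) \<and>
      \<comment> \<open>(4)\<close>
      (\<forall>\<mu> i j. \<mu> \<le> s \<and> i \<le> s \<and> j \<le> s \<and> odd (\<mu> + i + j) \<longrightarrow> q \<mu> i j = 0) \<and>
      \<comment> \<open>(5)\<close>
      Q_polynomial s q \<and>
      (\<forall>i\<le>s. q 1 i i = 0) \<and>
      \<comment> \<open>The values below are those of a spherical 2-design; this is automatic for s \<ge> 3 and
          can fail for s \<le> 2, where t may be less than 2.\<close>
      (s \<ge> 3 \<or> spherical_design 2 X \<longrightarrow>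
        (\<forall>i. 1 \<le> i \<and> i + 2 \<le> s \<longrightarrow>
           q 1 (i - 1) i = real n * real i / (real n + 2 * real i - 2)) \<and>
        (s \<ge> 2 \<longrightarrow>
           q 1 (s - 2) (s - 1) =
             2 * real n * (real n - 1) * fact (n + s - 4) /
             (fact (s - 2) * fact (n - 1) * real (card X) - 2 * (real s - 2) * fact (n + s - 4))) \<and>
        q 1 (s - 1) s = real n \<and>
        q 1 1 0 = real n \<and>
        (\<forall>i. 1 \<le> i \<and> i + 3 \<le> s \<longrightarrow>
           q 1 (i + 1) i = real n * (real n + real i - 2) / (real n + 2 * real i - 2)) \<and>
        (s \<ge> 2 \<and> n + 2 * s \<noteq> 6 \<longrightarrow>
           q 1 (s - 1) (s - 2) = real n * (real n + real s - 4) / (real n + 2 * real s - 6)) \<and>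
        (s \<ge> 2 \<longrightarrow>
           q 1 s (s - 1) =
             (fact (s - 2) * fact n * real (card X) - 2 * real n * fact (n + s - 3)) /
             (fact (s - 2) * fact (n - 1) * real (card X) - 2 * (real s - 2) * fact (n + s - 4)))))"
proof -
  interpret antipodal_design X n s t
    using n antipodal design dist t by unfold_locales
  obtain \<alpha> where ord: "inner_product_ordering X s \<alpha>"
    and pairs: "\<And>i. 2 * i + 1 \<le> s \<Longrightarrow> \<alpha> (2 * i + 1) = - \<alpha> (2 * i)" and mid: "even s \<Longrightarrow> \<alpha> s = 0"
    using antipodal_ordering_exists by blast
  have \<alpha>0: "\<alpha> 0 = 1"
    using ord by (simp add: inner_product_ordering_def)
  have \<alpha>1: "\<alpha> 1 = - 1"
    using pairs[of 0] s_pos \<alpha>0 by simp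
  define D where "D = (\<lambda>i. adj_mat (inner_rel X \<alpha> i))"
  define P where "P = (\<lambda>j i. N * fourier (\<lambda>u. of_bool (u = \<alpha> j)) i)"
  define Q where "Q = (\<lambda>j i. efun j (\<alpha> i))"
  have Q0: "Q i 0 = mult i" for i
    by (simp add: Q_def \<alpha>0 mult_def)
  have "\<forall>i\<le>s. P 1 i = (- 1) ^ i"
    unfolding P_def \<alpha>1 using fourier_minus_one by blast
  moreover have "\<forall>i j. 2 * i + 1 \<le> s \<and> j \<le> s \<longrightarrow> Q j (2 * i + 1) = (- 1) ^ j * Q j (2 * i)"
    unfolding Q_def using pairs by (simp add: efun_uminus)
  moreover have "even s \<longrightarrow> (\<forall>j. odd j \<and> j < s \<longrightarrow> Q j s = 0)"
  proof (intro impI allI)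
    fix j assume "even s" "odd j \<and> j < s"
    then show "Q j s = 0"
      using mid efun_uminus[of j 0] by (simp add: Q_def)
  qed
  moreover have "\<forall>i. i + 2 \<le> s \<longrightarrow>
      Q i 0 = ibinom (int n + int i - 1) (int i) - ibinom (int n + int i - 3) (int i - 2)"
    unfolding Q0 using mult_low_ibinom by blast
  moreover have "Q (s - 1) 0 = real (card X) / 2 - ibinom (int n + int s - 4) (int s - 3)"
    "Q s 0 = real (card X) / 2 - ibinom (int n + int s - 3) (int s - 2)"
    unfolding Q0 mult_high_ibinom N_def by (rule refl)+
  moreover have "\<forall>\<mu> i j. \<mu> \<le> s \<and> i \<le> s \<and> j \<le> s \<and> odd (\<mu> + i + j) \<longrightarrow> krein \<mu> i j = 0"
    using krein_odd by blast
  moreover have "\<forall>i\<le>s. krein 1 i i = 0"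
    using krein_odd by simp
  moreover note conclusions = calculation
  have krein_values: "(s \<ge> 3 \<or> spherical_design 2 X \<longrightarrow>
        (\<forall>i. 1 \<le> i \<and> i + 2 \<le> s \<longrightarrow>
           krein 1 (i - 1) i = real n * real i / (real n + 2 * real i - 2)) \<and>
        (s \<ge> 2 \<longrightarrow>
           krein 1 (s - 2) (s - 1) =
             2 * real n * (real n - 1) * fact (n + s - 4) /
             (fact (s - 2) * fact (n - 1) * real (card X) - 2 * (real s - 2) * fact (n + s - 4))) \<and>
        krein 1 (s - 1) s = real n \<and>
        krein 1 1 0 = real n \<and>
        (\<forall>i. 1 \<le> i \<and> i + 3 \<le> s \<longrightarrow>
           krein 1 (i + 1) i = real n * (real n + real i - 2) / (real n + 2 * real i - 2)) \<and>
        (s \<ge> 2 \<and> n + 2 * s \<noteq> 6 \<longrightarrow>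
           krein 1 (s - 1) (s - 2) = real n * (real n + real s - 4) / (real n + 2 * real s - 6)) \<and>
        (s \<ge> 2 \<longrightarrow>
           krein 1 s (s - 1) =
             (fact (s - 2) * fact n * real (card X) - 2 * real n * fact (n + s - 3)) /
             (fact (s - 2) * fact (n - 1) * real (card X) - 2 * (real s - 2) * fact (n + s - 4))))"
    (is "_ \<longrightarrow> ?values")
  proof
    assume "s \<ge> 3 \<or> spherical_design 2 X"
    then have m: "mult 1 = real n" by (rule mult_1)
    show ?values
      using krein_1_pred krein_1_pred_high[OF m] krein_1_last[unfolded m] krein_1_10[unfolded m]
        krein_1_succ_low krein_1_succ_high[OF m] krein_1_last_pred[OF m] by blast
  qed
  have "idempotent_ordering X s D idem_mat" "first_eigenmatrix s D idem_mat P"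
    "second_eigenmatrix X s D idem_mat Q"
    unfolding D_def P_def Q_def
    by (rule idempotent_ordering_idem_mat[OF ord] first_eigenmatrix_fourier[OF ord]
        second_eigenmatrix_efun[OF ord])+
  note matrices = this
  show ?thesis
    by (rule conjI, use association_scheme_inner_rel in blast, rule exI[of _ \<alpha>], rule exI[of _ D],
        rule exI[of _ idem_mat], rule exI[of _ P], rule exI[of _ Q], rule exI[of _ krein], intro conjI)
      (fact ord D_def matrices krein_numbers_krein conclusions Q_polynomial_krein krein_values)+
qed

end
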